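(* Let $n\ge 7$ be an integer and let $G$ be an $F_2$-free graph on $n$ vertices. Then \[ \lambda(G)\le \lambda\bigl(K^+_{\lfloor n/2\rfloor,\lceil n/2\rceil}\bigr), \] with equality if and only if $G=K^+_{\lfloor n/2\rfloor,\lceil n/2\rceil}$.
   Context: All graphs are finite, simple and undirected. $\lambda(G)$ denotes the spectral radius of $G$, i.e. the largest eigenvalue of its adjacency matrix. $F_2$ (the bowtie) is the graph consisting of two triangles sharing exactly one common vertex (5 vertices, 6 edges). A graph is $F_2$-free if it contains no subgraph isomorphic to $F_2$. $K^+_{\lfloor n/2\rfloor,\lceil n/2\rceil}$ denotes the graph obtained from the complete bipartite graph $K_{\lfloor n/2\rfloor,\lceil n/2\rceil}$ (parts of sizes $\lfloor n/2\rfloor$ and $\lceil n/2\rceil$) by adding one edge inside the part of size $\lfloor n/2\rfloor$. *)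

theory Defs
  imports
    "Graph_Theory.Graph_Theory"
    "Jordan_Normal_Form.Spectral_Radius"
begin

text \<open>
  A finite simple undirected graph is a \<open>pair_graph\<close>: a finite vertex set together with an
  irreflexive symmetric set of ordered pairs, each edge being represented by its two orientations.
\<close>

definition adjacency_matrix :: "'a pair_pre_digraph \<Rightarrow> 'a list \<Rightarrow> real mat" where
  "adjacency_matrix G vs =
     mat (length vs) (length vs) (\<lambda>(i, j). of_bool ((vs ! i, vs ! j) \<in> parcs G))"

definition vertex_ordering :: "'a pair_pre_digraph \<Rightarrow> 'a list \<Rightarrow> bool" where
  "vertex_ordering G vs \<longleftrightarrow> distinct vs \<and> set vs = pverts G"

text \<open>
  The library constant \<open>spectrum\<close> is the set of eigenvalues. The vertex ordering chosen here is
  irrelevant, see \<open>graph_spectral_radius_eq\<close> below. An adjacency matrix is real symmetric, so all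
  its eigenvalues are real and the spectrum of the real matrix misses none of them.
\<close>

definition graph_spectral_radius :: "'a pair_pre_digraph \<Rightarrow> real" where
  "graph_spectral_radius G =
     Max (spectrum (adjacency_matrix G (SOME vs. vertex_ordering G vs)))"

definition bowtie :: "nat pair_pre_digraph" where
  "bowtie = mk_symmetric (with_proj
     \<lparr> pverts = {..<5}, parcs = {(0, 1), (0, 2), (1, 2), (0, 3), (0, 4), (3, 4)} \<rparr>)"

text \<open>Subgraphs are not required to be induced.\<close>

definition graph_free :: "'b pair_pre_digraph \<Rightarrow> 'a pair_pre_digraph \<Rightarrow> bool" where
  "graph_free F G \<longleftrightarrow>
     \<not> (\<exists>H :: 'a pair_pre_digraph. subgraph (with_proj H) (with_proj G) \<and>
          digraph_iso (with_proj F) (with_proj H))"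

definition complete_bipartite :: "nat \<Rightarrow> nat \<Rightarrow> nat pair_pre_digraph" where
  "complete_bipartite a b =
     \<lparr> pverts = {..<a + b},
       parcs = {..<a} \<times> {a..<a + b} \<union> {a..<a + b} \<times> {..<a} \<rparr>"

text \<open>
  The added edge joins the vertices 0 and 1, which both lie in the part of size \<open>a\<close> provided
  \<open>a \<ge> 2\<close>.
\<close>

definition complete_bipartite_plus :: "nat \<Rightarrow> nat \<Rightarrow> nat pair_pre_digraph" where
  "complete_bipartite_plus a b =
     (complete_bipartite a b) \<lparr> parcs := parcs (complete_bipartite a b) \<union> {(0, 1), (1, 0)} \<rparr>"

lemma complete_bipartite: "K\<^bsub>a,b\<^esub> (with_proj (complete_bipartite a b))"
  unfolding complete_bipartite_digraph_pair_def
  by (intro conjI exI[of _ "{..<a}"] exI[of _ "{a..<a + b}"]) (auto simp: complete_bipartite_def)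

lemma pair_graph_complete_bipartite_plus:
  assumes "a \<ge> 2"
  shows "pair_graph (complete_bipartite_plus a b)"
  using assms
  by unfold_locales
    (auto simp: complete_bipartite_plus_def complete_bipartite_def symmetric_def intro!: symI)

lemma pair_graph_bowtie: "pair_graph bowtie"
  by unfold_locales (auto simp: bowtie_def mk_symmetric_def symmetric_def intro!: symI)

lemma eigenvalue_adjacency_matrix_iff:
  assumes vs: "distinct vs"
  shows "eigenvalue (adjacency_matrix G vs) k \<longleftrightarrow>
    (\<exists>x :: 'a \<Rightarrow> real. (\<exists>v\<in>set vs. x v \<noteq> 0) \<and>
       (\<forall>u\<in>set vs. (\<Sum>v\<in>set vs. of_bool ((u, v) \<in> parcs G) * x v) = k * x u))"
    (is "_ \<longleftrightarrow> ?R")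
proof -
  let ?n = "length vs"
  have bij: "bij_betw ((!) vs) {0..<?n} (set vs)"
    using bij_betw_nth[OF vs, of "{0..<?n}" "set vs"] by (simp add: atLeast0LessThan)
  have mult: "(adjacency_matrix G vs *\<^sub>v vec ?n (\<lambda>i. x (vs ! i))) $ i
      = (\<Sum>v\<in>set vs. of_bool ((vs ! i, v) \<in> parcs G) * x v)" if "i < ?n" for x i
    using that sum.reindex_bij_betw[OF bij, of "\<lambda>v. of_bool ((vs ! i, v) \<in> parcs G) * x v"]
    by (simp add: adjacency_matrix_def scalar_prod_def)
  have ev: "eigenvector (adjacency_matrix G vs) (vec ?n (\<lambda>i. x (vs ! i))) k \<longleftrightarrow>
     (\<exists>v\<in>set vs. x v \<noteq> 0) \<and>
       (\<forall>u\<in>set vs. (\<Sum>v\<in>set vs. of_bool ((u, v) \<in> parcs G) * x v) = k * x u)" for x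
  proof -
    have "vec ?n (\<lambda>i. x (vs ! i)) \<noteq> 0\<^sub>v ?n \<longleftrightarrow> (\<exists>v\<in>set vs. x v \<noteq> 0)"
      by (auto simp: vec_eq_iff in_set_conv_nth Bex_def)
    moreover have "adjacency_matrix G vs *\<^sub>v vec ?n (\<lambda>i. x (vs ! i)) = k \<cdot>\<^sub>v vec ?n (\<lambda>i. x (vs ! i))
      \<longleftrightarrow> (\<forall>i<?n. (\<Sum>v\<in>set vs. of_bool ((vs ! i, v) \<in> parcs G) * x v) = k * x (vs ! i))"
      unfolding vec_eq_iff using mult by (auto simp: adjacency_matrix_def)
    ultimately show ?thesis
      unfolding eigenvector_def all_set_conv_all_nth by (simp add: adjacency_matrix_def)
  qed
  have surj: "\<exists>x. w = vec ?n (\<lambda>i. x (vs ! i))" if "w \<in> carrier_vec ?n" for w :: "real vec"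
  proof
    show "w = vec ?n (\<lambda>i. (\<lambda>v. w $ (the_inv_into {0..<?n} ((!) vs) v)) (vs ! i))"
      using that the_inv_into_f_f[OF bij_betw_imp_inj_on[OF bij]] by (intro eq_vecI) auto
  qed
  show ?thesis
  proof
    assume "eigenvalue (adjacency_matrix G vs) k"
    then obtain w where w: "eigenvector (adjacency_matrix G vs) w k"
      by (auto simp: eigenvalue_def)
    then have "w \<in> carrier_vec ?n" by (simp add: eigenvector_def adjacency_matrix_def)
    with surj w ev show ?R by blast
  next
    assume ?R
    with ev show "eigenvalue (adjacency_matrix G vs) k" by (auto simp: eigenvalue_def)
  qed
qed

lemma graph_spectral_radius_eq:
  assumes "vertex_ordering G vs"
  shows "graph_spectral_radius G = Max (spectrum (adjacency_matrix G vs))"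
proof -
  have "vertex_ordering G (SOME vs. vertex_ordering G vs)"
    using assms by (rule someI)
  then have "spectrum (adjacency_matrix G (SOME vs. vertex_ordering G vs))
      = spectrum (adjacency_matrix G vs)"
    using assms unfolding spectrum_def vertex_ordering_def
    by (intro Collect_cong) (simp only: eigenvalue_adjacency_matrix_iff)
  then show ?thesis by (simp add: graph_spectral_radius_def)
qed

end

theory Submission
  imports Defs "HOL-Analysis.Function_Topology"
begin

text \<open>
  Take a bowtie-free graph of maximal spectral radius \<open>\<lambda>\<close> on the given vertex set, a positive
  eigenvector \<open>x\<close> and a vertex \<open>z\<close> at which \<open>x\<close> is largest. Since \<open>K\<^sup>+\<close> competes,
  \<open>\<lambda>\<^sup>2 > \<lfloor>n\<^sup>2/4\<rfloor> + 2\<close>; on the other hand \<open>\<lambda>\<^sup>2\<close> is at most the number of walks of length 2 from \<open>z\<close>.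
  Counting these walks shows that there is no \<open>K\<^sub>4\<close> and that \<open>z\<close> lies on the spine \<open>zb\<close> of a book
  with at least two pages.

  A vertex which is not on such a spine can be duplicated without creating a bowtie. Replacing
  a vertex by a twin of a non-adjacent one (Zykov symmetrization) therefore shows that non-adjacent
  non-spine vertices have equal neighbourhoods. Let \<open>P\<close> be the set of pages of \<open>zb\<close>, all with
  neighbourhood \<open>D \<union> {z, b}\<close>. Any remaining vertices form the spine \<open>wa\<close> of a second book with pages
  in \<open>D\<close>; as \<open>z\<close> is non-adjacent to one of \<open>w\<close>, \<open>a\<close>, say to \<open>a\<close>, replacing the edge \<open>wa\<close> by \<open>za\<close>
  does not decrease the quadratic form at \<open>x\<close>, which contradicts extremality. Hence the graph is
  complete bipartite between \<open>P\<close> and \<open>D \<union> {z, b}\<close> plus the edge \<open>zb\<close>, and the part sizes follow from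
  the explicit equation for \<open>\<lambda>\<close>.
\<close>

section \<open>Rayleigh quotients of graphs\<close>

definition graph_on :: "'a set \<Rightarrow> ('a \<times> 'a) set \<Rightarrow> bool" where
  "graph_on V E \<longleftrightarrow> finite V \<and> E \<subseteq> V \<times> V \<and> sym E \<and> (\<forall>v. (v, v) \<notin> E)"

definition nbsum :: "('a \<times> 'a) set \<Rightarrow> ('a \<Rightarrow> real) \<Rightarrow> 'a \<Rightarrow> real" where
  "nbsum E x u = (\<Sum>v\<in>E `` {u}. x v)"

definition qform :: "('a \<times> 'a) set \<Rightarrow> ('a \<Rightarrow> real) \<Rightarrow> real" where
  "qform E x = (\<Sum>(u, v)\<in>E. x u * x v)"

definition lam :: "'a set \<Rightarrow> ('a \<times> 'a) set \<Rightarrow> real" where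
  "lam V E = graph_spectral_radius \<lparr>pverts = V, parcs = E\<rparr>"

lemma graph_onD:
  assumes "graph_on V E"
  shows "finite V" "finite E" "E \<subseteq> V \<times> V" "sym E" "(v, v) \<notin> E" "finite (E `` {u})" "E `` {u} \<subseteq> V"
proof -
  show "finite V" "E \<subseteq> V \<times> V" "sym E" "(v, v) \<notin> E" using assms by (auto simp: graph_on_def)
  then show "finite E" "E `` {u} \<subseteq> V" by (auto intro: finite_subset)
  then show "finite (E `` {u})" using \<open>finite V\<close> finite_subset by blast
qed

lemma sum_edges:
  assumes "graph_on V E"
  shows "(\<Sum>(u, v)\<in>E. f u v) = (\<Sum>u\<in>V. \<Sum>v\<in>E `` {u}. f u v)"
proof -
  have "E = Sigma V (\<lambda>u. E `` {u})" using graph_onD(3)[OF assms] by auto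
  moreover have "(\<Sum>(u, v)\<in>Sigma V (\<lambda>u. E `` {u}). f u v) = (\<Sum>u\<in>V. \<Sum>v\<in>E `` {u}. f u v)"
    by (rule sum.Sigma[symmetric]) (use graph_onD[OF assms] in auto)
  ultimately show ?thesis by simp
qed

lemma sum_edges_swap:
  assumes "graph_on V E"
  shows "(\<Sum>(u, v)\<in>E. f u v) = (\<Sum>(u, v)\<in>E. f v u)"
  by (rule sum.reindex_bij_witness[of _ prod.swap prod.swap])
    (use graph_onD(4)[OF assms] in \<open>auto dest: symD\<close>)

lemma qform_eq_nbsum:
  assumes "graph_on V E"
  shows "qform E x = (\<Sum>u\<in>V. x u * nbsum E x u)"
  unfolding qform_def nbsum_def sum_edges[OF assms] by (simp add: sum_distrib_left)

text \<open>Loop-freeness removes the term quadratic in \<open>t\<close>; the factor 2 reflects that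
  each edge occurs in both orientations.\<close>

lemma qform_perturb:
  assumes g: "graph_on V E" and u: "u \<in> V"
  shows "qform E (\<lambda>v. x v + (if v = u then t else 0)) = qform E x + 2 * t * nbsum E x u"
proof -
  let ?e = "\<lambda>v. if v = u then t else (0::real)"
  have 1: "(\<Sum>(a, b)\<in>E. ?e a * x b) = t * nbsum E x u"
  proof -
    have "(\<Sum>(a, b)\<in>E. ?e a * x b) = (\<Sum>a\<in>V. if a = u then t * nbsum E x u else 0)"
      unfolding sum_edges[OF g] nbsum_def by (intro sum.cong) (auto simp: sum_distrib_left)
    also have "\<dots> = t * nbsum E x u" using u graph_onD(1)[OF g] by simp
    finally show ?thesis .
  qed
  have 2: "(\<Sum>(a, b)\<in>E. x a * ?e b) = t * nbsum E x u"
    using sum_edges_swap[OF g, of "\<lambda>a b. x a * ?e b"] 1 by (simp add: mult.commute)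
  have "qform E (\<lambda>v. x v + ?e v) = (\<Sum>(a, b)\<in>E. x a * x b + ?e a * x b + x a * ?e b)"
    unfolding qform_def using graph_onD(5)[OF g]
    by (intro sum.cong) (auto simp: algebra_simps)
  also have "\<dots> = qform E x + (\<Sum>(a, b)\<in>E. ?e a * x b) + (\<Sum>(a, b)\<in>E. x a * ?e b)"
    unfolding qform_def by (simp add: sum.distrib case_prod_unfold)
  finally show ?thesis using 1 2 by simp
qed

lemma linear_le_quadratic_imp_zero:
  fixes c \<rho> :: real
  assumes "\<And>t. 2 * t * c \<le> \<rho> * t\<^sup>2"
  shows "c = 0"
proof -
  \<comment> \<open>Testing at \<open>t = c / r\<close> forces \<open>c = 0\<close> once
    \<open>\<rho> < 2 * r\<close>; the absolute value also keeps \<open>r\<close> positive.\<close>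
  define r where "r = \<bar>\<rho>\<bar> + 1"
  have r: "r > 0" "\<rho> < 2 * r" by (auto simp: r_def)
  have "2 * c\<^sup>2 / r \<le> \<rho> * c\<^sup>2 / r\<^sup>2"
    using assms[of "c / r"] by (simp add: power2_eq_square)
  then have "2 * r * c\<^sup>2 \<le> \<rho> * c\<^sup>2"
    using r by (simp add: field_simps power2_eq_square)
  then have "(2 * r - \<rho>) * c\<^sup>2 \<le> 0" by (simp add: algebra_simps)
  then show ?thesis using r by (simp add: mult_le_0_iff)
qed

text \<open>First-order condition: if \<open>\<rho>\<close> bounds the Rayleigh quotient and
  \<open>x\<close> attains the bound, then moving the single coordinate \<open>u\<close> cannot
  improve on it, so the derivative in that direction vanishes.\<close>

lemma qform_eq_imp_eigen:
  assumes g: "graph_on V E" and ub: "\<And>y. qform E y \<le> \<rho> * (\<Sum>v\<in>V. (y v)\<^sup>2)"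
    and eq: "qform E x = \<rho> * (\<Sum>v\<in>V. (x v)\<^sup>2)" and u: "u \<in> V"
  shows "nbsum E x u = \<rho> * x u"
proof -
  have "2 * t * (nbsum E x u - \<rho> * x u) \<le> \<rho> * t\<^sup>2" for t
  proof -
    have "(\<Sum>v\<in>V. (x v + (if v = u then t else 0))\<^sup>2)
        = (\<Sum>v\<in>V. (x v)\<^sup>2 + (if v = u then 2 * t * x u + t\<^sup>2 else 0))"
      by (intro sum.cong) (auto simp: power2_eq_square algebra_simps)
    also have "\<dots> = (\<Sum>v\<in>V. (x v)\<^sup>2) + (2 * t * x u + t\<^sup>2)"
      using u graph_onD(1)[OF g] by (simp add: sum.distrib)
    finally have s: "(\<Sum>v\<in>V. (x v + (if v = u then t else 0))\<^sup>2)
        = (\<Sum>v\<in>V. (x v)\<^sup>2) + (2 * t * x u + t\<^sup>2)" .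
    from ub[of "\<lambda>v. x v + (if v = u then t else 0)"]
    show ?thesis unfolding s qform_perturb[OF g u] eq by (simp add: algebra_simps)
  qed
  then show ?thesis using linear_le_quadratic_imp_zero[of "nbsum E x u - \<rho> * x u" \<rho>] by simp
qed

section \<open>Existence of a maximizer and its link to the spectral radius\<close>

lemma qform_attains_max_on_sphere:
  assumes g: "graph_on V E" and ne: "V \<noteq> {}"
  shows "\<exists>x. (\<Sum>v\<in>V. (x v)\<^sup>2) = 1 \<and> (\<forall>y. qform E y \<le> qform E x * (\<Sum>v\<in>V. (y v)\<^sup>2))"
proof -
  note fin = graph_onD(1)[OF g]
  \<comment> \<open>Vectors are functions on the whole type, so the coordinates outside
    \<open>V\<close> are pinned to 0; \<open>K\<close> is then a product of compact sets, compact by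
    Tychonoff's theorem.\<close>
  define K where "K = PiE UNIV (\<lambda>v. if v \<in> V then {-1..1::real} else {0})"
  define S where "S = {x\<in>K. (\<Sum>v\<in>V. (x v)\<^sup>2) = 1}"
  have "compactin (product_topology (\<lambda>i. euclidean) UNIV) K"
    unfolding K_def compactin_PiE by auto
  then have "compact K" by (simp add: euclidean_product_topology)
  moreover have "closed {x::'a \<Rightarrow> real. (\<Sum>v\<in>V. (x v)\<^sup>2) = 1}"
    by (intro closed_Collect_eq continuous_intros) auto
  moreover have "S = K \<inter> {x. (\<Sum>v\<in>V. (x v)\<^sup>2) = 1}" by (auto simp: S_def)
  ultimately have comp: "compact S" by (simp add: compact_Int_closed)
  from ne obtain w where w: "w \<in> V" by blast
  have "(\<lambda>v. if v = w then 1 else 0) \<in> S"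
  proof -
    have "(\<Sum>v\<in>V. (if v = w then 1 else 0 :: real)\<^sup>2) = (\<Sum>v\<in>V. if v = w then 1 else 0)"
      by (intro sum.cong) auto
    then show ?thesis using w fin by (auto simp: S_def K_def)
  qed
  then have "S \<noteq> {}" by blast
  moreover have "continuous_on S (qform E)"
    unfolding qform_def case_prod_unfold
    by (intro continuous_intros continuous_on_subset[OF continuous_on_product_coordinates]) auto
  ultimately obtain x where x: "x \<in> S" "\<And>y. y \<in> S \<Longrightarrow> qform E y \<le> qform E x"
    using continuous_attains_sup[OF comp] by metis
  have "qform E y \<le> qform E x * (\<Sum>v\<in>V. (y v)\<^sup>2)" for y
  proof (cases "(\<Sum>v\<in>V. (y v)\<^sup>2) = 0")
    case True
    then have "\<forall>v\<in>V. y v = 0" using fin by (simp add: sum_nonneg_eq_0_iff)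
    then have "qform E y = 0"
      unfolding qform_def using graph_onD(3)[OF g] by (intro sum.neutral) auto
    then show ?thesis using True by simp
  next
    case False
    define s where "s = sqrt (\<Sum>v\<in>V. (y v)\<^sup>2)"
    have s: "s > 0" "s\<^sup>2 = (\<Sum>v\<in>V. (y v)\<^sup>2)"
      using False sum_nonneg[of V "\<lambda>v. (y v)\<^sup>2"] by (auto simp: s_def)
    define z where "z v = (if v \<in> V then y v / s else 0)" for v
    have z1: "(\<Sum>v\<in>V. (z v)\<^sup>2) = 1"
    proof -
      have "(\<Sum>v\<in>V. (z v)\<^sup>2) = (\<Sum>v\<in>V. (y v)\<^sup>2 / s\<^sup>2)"
        by (intro sum.cong) (auto simp: z_def power_divide)
      also have "\<dots> = (\<Sum>v\<in>V. (y v)\<^sup>2) / s\<^sup>2" by (simp add: sum_divide_distrib)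
      finally show ?thesis using s False by simp
    qed
    have "z v \<in> {-1..1}" if "v \<in> V" for v
    proof -
      have "(z v)\<^sup>2 \<le> 1" using member_le_sum[OF that, of "\<lambda>v. (z v)\<^sup>2"] fin z1 by simp
      then show ?thesis by (simp add: abs_square_le_1 abs_le_iff)
    qed
    then have "z \<in> S" using z1 by (auto simp: S_def K_def z_def)
    then have "qform E z \<le> qform E x" by (rule x)
    moreover have "qform E z = qform E y / s\<^sup>2"
      unfolding qform_def sum_divide_distrib using graph_onD(3)[OF g]
      by (intro sum.cong) (auto simp: z_def power2_eq_square)
    ultimately have "qform E y \<le> qform E x * s\<^sup>2" using s(1) by (simp add: pos_divide_le_eq)
    then show ?thesis by (simp only: s(2))
  qed
  then show ?thesis using x by (auto simp: S_def)
qed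

lemma sum_of_bool_edges:
  assumes "graph_on V E" "u \<in> V"
  shows "(\<Sum>v\<in>V. of_bool ((u, v) \<in> E) * x v) = nbsum E x u"
proof -
  have "(\<Sum>v\<in>V. of_bool ((u, v) \<in> E) * x v) = (\<Sum>v\<in>E `` {u}. of_bool ((u, v) \<in> E) * x v)"
    by (rule sum.mono_neutral_right) (use graph_onD[OF assms(1)] in auto)
  also have "\<dots> = nbsum E x u" unfolding nbsum_def by (intro sum.cong) auto
  finally show ?thesis .
qed

text \<open>The first-order condition makes \<open>\<rho>\<close> an eigenvalue, and any eigenvalue
  is the Rayleigh quotient of its eigenvector, hence at most \<open>\<rho>\<close>.\<close>

lemma lam_eqI:
  assumes g: "graph_on V E" and ub: "\<And>y. qform E y \<le> \<rho> * (\<Sum>v\<in>V. (y v)\<^sup>2)"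
    and x: "(\<Sum>v\<in>V. (x v)\<^sup>2) = 1" "qform E x = \<rho>"
  shows "lam V E = \<rho>"
proof -
  let ?G = "\<lparr>pverts = V, parcs = E\<rparr>"
  obtain vs where vs: "distinct vs" "set vs = V"
    using finite_distinct_list[OF graph_onD(1)[OF g]] by blast
  let ?A = "adjacency_matrix ?G vs"
  have spec: "k \<in> spectrum ?A \<longleftrightarrow> (\<exists>x. (\<exists>v\<in>V. x v \<noteq> 0) \<and> (\<forall>u\<in>V. nbsum E x u = k * x u))" for k
    unfolding spectrum_def mem_Collect_eq eigenvalue_adjacency_matrix_iff[OF vs(1)] vs(2)
    using sum_of_bool_edges[OF g] by simp
  have "finite (spectrum ?A)"
    by (rule card_finite_spectrum(1)[of _ "length vs"]) (simp add: adjacency_matrix_def)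
  moreover have "\<rho> \<in> spectrum ?A"
  proof -
    have "\<exists>v\<in>V. x v \<noteq> 0"
    proof (rule ccontr)
      assume "\<not> ?thesis"
      then have "(\<Sum>v\<in>V. (x v)\<^sup>2) = 0" by (intro sum.neutral) auto
      then show False using x by simp
    qed
    moreover have "nbsum E x u = \<rho> * x u" if "u \<in> V" for u
      using qform_eq_imp_eigen[OF g ub _ that] x by simp
    ultimately show ?thesis unfolding spec by blast
  qed
  moreover have "k \<le> \<rho>" if "k \<in> spectrum ?A" for k
  proof -
    from that obtain y where y: "\<exists>v\<in>V. y v \<noteq> 0" "\<And>u. u \<in> V \<Longrightarrow> nbsum E y u = k * y u"
      unfolding spec by blast
    have "k * (\<Sum>v\<in>V. (y v)\<^sup>2) = qform E y"
      unfolding qform_eq_nbsum[OF g] sum_distrib_left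
      by (intro sum.cong) (auto simp: y power2_eq_square)
    also have "\<dots> \<le> \<rho> * (\<Sum>v\<in>V. (y v)\<^sup>2)" by (rule ub)
    finally have "k * (\<Sum>v\<in>V. (y v)\<^sup>2) \<le> \<rho> * (\<Sum>v\<in>V. (y v)\<^sup>2)" .
    moreover have "(\<Sum>v\<in>V. (y v)\<^sup>2) > 0"
    proof -
      from y(1) obtain v where "v \<in> V" "y v \<noteq> 0" by blast
      then show ?thesis using graph_onD(1)[OF g] by (intro sum_pos2[of _ v]) auto
    qed
    ultimately show ?thesis by simp
  qed
  ultimately have "Max (spectrum ?A) = \<rho>" by (intro Max_eqI) auto
  then show ?thesis
    unfolding lam_def using graph_spectral_radius_eq[of ?G vs] vs by (simp add: vertex_ordering_def)
qed

lemma ex_lam_maximizer: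
  assumes g: "graph_on V E" and ne: "V \<noteq> {}"
  shows "\<exists>x. (\<Sum>v\<in>V. (x v)\<^sup>2) = 1 \<and> qform E x = lam V E \<and>
    (\<forall>y. qform E y \<le> lam V E * (\<Sum>v\<in>V. (y v)\<^sup>2))"
proof -
  from qform_attains_max_on_sphere[OF assms] obtain x where
    x: "(\<Sum>v\<in>V. (x v)\<^sup>2) = 1" "\<And>y. qform E y \<le> qform E x * (\<Sum>v\<in>V. (y v)\<^sup>2)" by blast
  have "lam V E = qform E x" by (rule lam_eqI[OF g x(2) x(1)]) simp
  then show ?thesis using x by metis
qed

lemma qform_le_lam:
  assumes "graph_on V E" "V \<noteq> {}"
  shows "qform E y \<le> lam V E * (\<Sum>v\<in>V. (y v)\<^sup>2)"
  using ex_lam_maximizer[OF assms] by blast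

lemma qform_eq_lam_imp_eigen:
  assumes "graph_on V E" "qform E x = lam V E * (\<Sum>v\<in>V. (x v)\<^sup>2)" "u \<in> V"
  shows "nbsum E x u = lam V E * x u"
  using assms qform_le_lam[of V E] by (intro qform_eq_imp_eigen) auto

text \<open>Taking absolute values of a maximizer keeps its norm and cannot decrease the quadratic
  form. Strict positivity can fail here, as the graph may be disconnected; for extremal graphs it is
  recovered in \<open>extremal_eigenvector_pos\<close>.\<close>

lemma ex_nonneg_eigenvector:
  assumes g: "graph_on V E" and ne: "V \<noteq> {}"
  shows "\<exists>x. (\<forall>v. x v \<ge> 0) \<and> (\<exists>v\<in>V. x v > 0) \<and> (\<forall>u\<in>V. nbsum E x u = lam V E * x u)"
proof -
  from ex_lam_maximizer[OF assms] obtain y where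
    y: "(\<Sum>v\<in>V. (y v)\<^sup>2) = 1" "qform E y = lam V E" by blast
  define x where "x v = \<bar>y v\<bar>" for v
  have s: "(\<Sum>v\<in>V. (x v)\<^sup>2) = 1" using y by (simp add: x_def)
  have "qform E y \<le> qform E x"
    unfolding qform_def x_def by (intro sum_mono) (auto simp: abs_mult[symmetric])
  then have "qform E x = lam V E"
    using qform_le_lam[OF assms, of x] y s by simp
  then have "nbsum E x u = lam V E * x u" if "u \<in> V" for u
    using qform_eq_lam_imp_eigen[OF g _ that, of x] s by simp
  moreover have "\<exists>v\<in>V. x v > 0"
  proof (rule ccontr)
    assume "\<not> ?thesis"
    then have "(\<Sum>v\<in>V. (x v)\<^sup>2) = 0" by (intro sum.neutral) (auto simp: x_def)
    then show False using s by simp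
  qed
  ultimately show ?thesis by (intro exI[of _ x]) (auto simp: x_def)
qed

section \<open>Walks of length two in bowtie-free graphs\<close>

text \<open>
  The listed equalities are the only ones that loop-freeness does not already exclude among the five
  vertices of a bowtie with centre \<open>a\<close>.
\<close>

definition bowtie_free :: "('a \<times> 'a) set \<Rightarrow> bool" where
  "bowtie_free E \<longleftrightarrow> (\<forall>a b c d e.
     (a, b) \<in> E \<and> (a, c) \<in> E \<and> (b, c) \<in> E \<and> (a, d) \<in> E \<and> (a, e) \<in> E \<and> (d, e) \<in> E \<longrightarrow>
     b = d \<or> b = e \<or> c = d \<or> c = e)"

text \<open>
  \<open>spine E u\<close>: the vertex \<open>u\<close> lies on an edge contained in two triangles.
\<close>

definition spine :: "('a \<times> 'a) set \<Rightarrow> 'a \<Rightarrow> bool" where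
  "spine E u \<longleftrightarrow> (\<exists>a c e. c \<noteq> e \<and>
     (u, a) \<in> E \<and> (u, c) \<in> E \<and> (u, e) \<in> E \<and> (a, c) \<in> E \<and> (a, e) \<in> E)"

definition clique4 :: "('a \<times> 'a) set \<Rightarrow> 'a set \<Rightarrow> bool" where
  "clique4 E Q \<longleftrightarrow> card Q = 4 \<and> (\<forall>u\<in>Q. \<forall>v\<in>Q. u \<noteq> v \<longrightarrow> (u, v) \<in> E)"

lemma bowtie_freeD:
  assumes "bowtie_free E" "(a, b) \<in> E" "(a, c) \<in> E" "(b, c) \<in> E" "(a, d) \<in> E" "(a, e) \<in> E" "(d, e) \<in> E"
  shows "b = d \<or> b = e \<or> c = d \<or> c = e"
  using assms unfolding bowtie_free_def by blast

lemma clique4I: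
  assumes "graph_on V E" "(a, b) \<in> E" "(a, c) \<in> E" "(a, d) \<in> E" "(b, c) \<in> E" "(b, d) \<in> E" "(c, d) \<in> E"
  shows "clique4 E {a, b, c, d}"
proof -
  have "a \<noteq> b" "a \<noteq> c" "a \<noteq> d" "b \<noteq> c" "b \<noteq> d" "c \<noteq> d"
    using assms graph_onD(5)[OF assms(1)] by auto
  then show ?thesis
    using assms graph_onD(4)[OF assms(1)] by (auto simp: clique4_def dest: symD)
qed

lemma clique4_subset:
  assumes "graph_on V E" "clique4 E Q"
  shows "Q \<subseteq> V"
proof
  fix q assume q: "q \<in> Q"
  have "card Q = 4" using assms by (simp add: clique4_def)
  then have "Q \<noteq> {q}" by auto
  with q obtain r where "r \<in> Q" "r \<noteq> q" by blast
  with q assms(2) have "(q, r) \<in> E" by (auto simp: clique4_def)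
  then show "q \<in> V" using graph_onD(3)[OF assms(1)] by auto
qed

text \<open>If an outside vertex \<open>v\<close> saw two clique vertices \<open>q\<close>,
  \<open>q'\<close>, the triangle \<open>q v q'\<close> and the triangle of \<open>q\<close> with
  the other two clique vertices would form a bowtie centred at \<open>q\<close>.\<close>

lemma clique4_outside:
  assumes g: "graph_on V E" and bf: "bowtie_free E" and Q: "clique4 E Q" and v: "v \<notin> Q"
    and q: "q \<in> Q" "q' \<in> Q" "(v, q) \<in> E" "(v, q') \<in> E"
  shows "q = q'"
proof (rule ccontr)
  assume ne: "q \<noteq> q'"
  have "card (Q - {q, q'}) = 2"
    using Q q ne by (simp add: clique4_def card_Diff_subset)
  then obtain r s where rs: "Q - {q, q'} = {r, s}" "r \<noteq> s" by (meson card_2_iff)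
  then have "r \<in> Q" "s \<in> Q" "r \<noteq> q" "s \<noteq> q" "r \<noteq> q'" "s \<noteq> q'" by auto
  then show False
    using bowtie_freeD[OF bf, of q v q' r s] Q q ne rs(2) v graph_onD(4)[OF g]
    by (auto simp: clique4_def dest: symD)
qed

text \<open>Bowtie-freeness at \<open>z\<close> means that any two edges inside its neighbourhood
  meet. Pairwise meeting edges form a star or a triangle, and a triangle would give a
  \<open>K4\<close> through \<open>z\<close>; \<open>b\<close> is the centre of the star.\<close>

lemma ex_star_center:
  assumes g: "graph_on V E" and bf: "bowtie_free E" and z: "\<And>Q. clique4 E Q \<Longrightarrow> z \<notin> Q"
    and ne: "E `` {z} \<noteq> {}"
  shows "\<exists>b\<in>E `` {z}. \<forall>w\<in>E `` {z}. w \<noteq> b \<longrightarrow> E `` {z} \<inter> E `` {w} \<subseteq> {b}"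
proof (rule ccontr)
  assume no: "\<not> ?thesis"
  have sy: "(v, u) \<in> E" if "(u, v) \<in> E" for u v using that graph_onD(4)[OF g] by (auto dest: symD)
  have ex: "\<exists>u v. (z, u) \<in> E \<and> (z, v) \<in> E \<and> (u, v) \<in> E \<and> u \<noteq> b \<and> v \<noteq> b" if "(z, b) \<in> E" for b
    using no that by blast
  from ne obtain w where "(z, w) \<in> E" by auto
  from ex[OF this] obtain b p where bp: "(z, b) \<in> E" "(z, p) \<in> E" "(b, p) \<in> E" by blast
  \<comment> \<open>The edge that avoids \<open>d\<close> must still meet the edge
    \<open>dc\<close>, so it passes through \<open>c\<close> and supplies a second neighbour of
    \<open>c\<close>.\<close>
  have *: "\<exists>v. (z, v) \<in> E \<and> (c, v) \<in> E \<and> v \<noteq> d"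
    if cd: "(z, c) \<in> E" "(z, d) \<in> E" "(d, c) \<in> E" for c d
  proof -
    from ex[OF cd(2)] obtain u v where uv: "(z, u) \<in> E" "(z, v) \<in> E" "(u, v) \<in> E" "u \<noteq> d" "v \<noteq> d"
      by blast
    then have "u = c \<or> v = c" using bowtie_freeD[OF bf, of z d c u v] cd by auto
    then show ?thesis using uv sy by blast
  qed
  obtain v where v: "(z, v) \<in> E" "(p, v) \<in> E" "v \<noteq> b" using *[of p b] bp by blast
  obtain v' where v': "(z, v') \<in> E" "(b, v') \<in> E" "v' \<noteq> p" using *[of b p] bp sy by blast
  have "b \<noteq> p" using bp graph_onD(5)[OF g] by auto
  then have "v = v'" using bowtie_freeD[OF bf, of z p v b v'] v v' bp by blast
  then have "clique4 E {z, b, p, v}" using clique4I[OF g, of z b p v] bp v v' by blast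
  then show False using z by blast
qed

text \<open>The sum is the degree sum of the graph induced on the neighbourhood of \<open>z\<close>.
  That graph is a star, so its degree sum is at most twice the degree of its centre.\<close>

lemma codeg_nbrs_le:
  assumes g: "graph_on V E" and bf: "bowtie_free E" and z: "\<And>Q. clique4 E Q \<Longrightarrow> z \<notin> Q"
    and ne: "E `` {z} \<noteq> {}"
  shows "\<exists>b\<in>E `` {z}. (\<Sum>w\<in>E `` {z}. card (E `` {z} \<inter> E `` {w})) \<le> 2 * card (E `` {z} \<inter> E `` {b})"
proof -
  note fin = graph_onD(6)[OF g]
  obtain b where b: "b \<in> E `` {z}"
    "\<And>w. w \<in> E `` {z} \<Longrightarrow> w \<noteq> b \<Longrightarrow> E `` {z} \<inter> E `` {w} \<subseteq> {b}"
    using ex_star_center[OF assms] by blast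
  have "(\<Sum>w\<in>E `` {z} - {b}. card (E `` {z} \<inter> E `` {w}))
      \<le> (\<Sum>w\<in>E `` {z} - {b}. of_bool (w \<in> E `` {b}))"
  proof (rule sum_mono)
    fix w assume w: "w \<in> E `` {z} - {b}"
    show "card (E `` {z} \<inter> E `` {w}) \<le> of_bool (w \<in> E `` {b})"
    proof (cases "w \<in> E `` {b}")
      case True
      then show ?thesis using b(2)[of w] w card_mono[of "{b}" "E `` {z} \<inter> E `` {w}"] by simp
    next
      case False
      then have "E `` {z} \<inter> E `` {w} = {}" using b(2)[of w] w graph_onD(4)[OF g] by (auto dest: symD)
      then show ?thesis by simp
    qed
  qed
  also have "\<dots> = card ((E `` {z} - {b}) \<inter> E `` {b})"
    using fin by (simp add: sum_of_bool_eq Int_def)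
  also have "\<dots> \<le> card (E `` {z} \<inter> E `` {b})" using fin by (intro card_mono) auto
  finally show ?thesis using b(1) fin by (intro bexI[of _ b]) (auto simp: sum.remove[of _ b])
qed

section \<open>Upper bounds on the number of walks of length two\<close>

lemma mult_diff_le_floor:
  fixes d n :: nat
  assumes "d \<le> n"
  shows "d * (n - d) \<le> n div 2 * (n - n div 2)"
proof -
  define t where "t = int d - int (n div 2)"
  have d: "int d = int (n div 2) + t" by (simp add: t_def)
  have "int d * (int n - int d) \<le> int (n div 2) * (int n - int (n div 2))"
  proof (cases "even n")
    case True
    then have n: "int n = 2 * int (n div 2)" by presburger
    have "0 \<le> t * t" by simp
    then show ?thesis unfolding d by (subst (1 2) n) (simp add: algebra_simps)
  next
    case False
    then have n: "int n = 2 * int (n div 2) + 1" by presburger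
    \<comment> \<open>For odd \<open>n\<close> the deficit is \<open>t * t - t\<close>, which is
      nonnegative because \<open>t\<close> is an integer.\<close>
    have "t \<le> t * t"
    proof (cases "t \<le> 0")
      case True
      then show ?thesis using zero_le_square[of t] by linarith
    next
      case False
      then show ?thesis using mult_mono[of 1 t t t] by simp
    qed
    then show ?thesis unfolding d by (subst (1 2) n) (simp add: algebra_simps)
  qed
  moreover have "int (d * (n - d)) = int d * (int n - int d)" using assms by (simp add: of_nat_diff)
  moreover have "int (n div 2 * (n - n div 2)) = int (n div 2) * (int n - int (n div 2))"
    by (simp add: of_nat_diff)
  ultimately show ?thesis by linarith
qed

lemma codeg_outside_le:
  assumes g: "graph_on V E"
  shows "(\<Sum>w\<in>V - E `` {z}. card (E `` {z} \<inter> E `` {w}))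
    \<le> card (E `` {z}) * (card V - card (E `` {z}))"
proof -
  have "(\<Sum>w\<in>V - E `` {z}. card (E `` {z} \<inter> E `` {w})) \<le> (\<Sum>w\<in>V - E `` {z}. card (E `` {z}))"
    using graph_onD(6)[OF g] by (intro sum_mono card_mono) auto
  then show ?thesis using graph_onD[OF g] by (simp add: card_Diff_subset mult.commute)
qed

text \<open>The sum counts walks of length two from \<open>z\<close> by endpoint. With
  \<open>d\<close> the degree of \<open>z\<close>, at most \<open>d * (card V - d)\<close> of them
  end outside its neighbourhood. Those ending inside use edges of the star there, which has at most
  one edge when \<open>z\<close> is on no spine, so there are at most 2.\<close>

lemma walks2_le_of_not_spine:
  assumes g: "graph_on V E" and bf: "bowtie_free E" and z: "\<not> spine E z"
  shows "(\<Sum>w\<in>V. card (E `` {z} \<inter> E `` {w})) \<le> card V div 2 * (card V - card V div 2) + 2"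
proof (cases "E `` {z} = {}")
  case False
  note fin = graph_onD(1,6)[OF g] and sub = graph_onD(7)[OF g]
  have "z \<notin> Q" if Q: "clique4 E Q" for Q
  proof
    assume zQ: "z \<in> Q"
    then have "card (Q - {z}) = 3" using Q by (simp add: clique4_def)
    then obtain a c e where "Q - {z} = {a, c, e}" "a \<noteq> c" "a \<noteq> e" "c \<noteq> e"
      by (auto simp: card_3_iff)
    then have "a \<in> Q" "c \<in> Q" "e \<in> Q" "a \<noteq> z" "c \<noteq> z" "e \<noteq> z" "a \<noteq> c" "a \<noteq> e" "c \<noteq> e" by auto
    then have "spine E z"
      using Q zQ unfolding clique4_def spine_def by metis
    then show False using z by simp
  qed
  from codeg_nbrs_le[OF g bf this False] obtain b where b: "b \<in> E `` {z}"
    "(\<Sum>w\<in>E `` {z}. card (E `` {z} \<inter> E `` {w})) \<le> 2 * card (E `` {z} \<inter> E `` {b})" by blast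
  have "card (E `` {z} \<inter> E `` {b}) \<le> Suc 0"
    using z b(1) fin by (auto simp: card_le_Suc0_iff_eq spine_def)
  then have "(\<Sum>w\<in>E `` {z}. card (E `` {z} \<inter> E `` {w})) \<le> 2" using b by simp
  moreover have "(\<Sum>w\<in>V - E `` {z}. card (E `` {z} \<inter> E `` {w})) \<le> card V div 2 * (card V - card V div 2)"
    using codeg_outside_le[OF g, of z] mult_diff_le_floor[OF card_mono[OF fin(1) sub]] by (meson order_trans)
  ultimately show ?thesis using sum.subset_diff[OF sub[of z] fin(1), of "\<lambda>w. card (E `` {z} \<inter> E `` {w})"] by linarith
qed auto

text \<open>The clique absorbs few walks: a neighbour of \<open>z\<close> outside \<open>Q\<close>
  sees at most one vertex of \<open>Q\<close>, so the four endpoints in \<open>Q\<close> receive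
  about \<open>d\<close> walks instead of \<open>4 * d\<close>. This saving pays for the at most
  \<open>2 * (d - 1)\<close> walks ending in the neighbourhood of \<open>z\<close>.\<close>

lemma walks2_le_of_clique4_notin:
  assumes g: "graph_on V E" and bf: "bowtie_free E" and z: "\<And>Q. clique4 E Q \<Longrightarrow> z \<notin> Q"
    and Q: "clique4 E Q"
  shows "(\<Sum>w\<in>V. card (E `` {z} \<inter> E `` {w})) \<le> card V div 2 * (card V - card V div 2)"
proof (cases "E `` {z} = {}")
  case False
  let ?N = "E `` {z}" and ?c = "\<lambda>w. card (E `` {z} \<inter> E `` {w})"
  note fin = graph_onD(1,6)[OF g] and sub = graph_onD(7)[OF g]
  have Q4: "card Q = 4" "finite Q" "Q \<subseteq> V"
    using Q clique4_subset[OF g Q] by (auto simp: clique4_def intro: card_ge_0_finite)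
  define d where "d = card ?N"
  define k where "k = card (?N \<inter> Q)"
  have d: "d \<ge> 1" using False fin by (simp add: d_def Suc_le_eq card_gt_0_iff)
  have k: "k \<le> 1"
    using clique4_outside[OF g bf Q z[OF Q]] Q4 by (auto simp: k_def card_le_Suc0_iff_eq)
  have "(\<Sum>w\<in>?N. ?c w) \<le> 2 * (d - 1)"
  proof -
    from codeg_nbrs_le[OF g bf z False] obtain b where b: "b \<in> ?N" "(\<Sum>w\<in>?N. ?c w) \<le> 2 * ?c b" by blast
    have "?N \<inter> E `` {b} \<subseteq> ?N - {b}" using graph_onD(5)[OF g] by auto
    then have "?c b \<le> card (?N - {b})" using fin by (intro card_mono) auto
    then show ?thesis using b by (simp add: d_def)
  qed
  moreover have "(\<Sum>w\<in>Q. ?c w) \<le> d + 2 * k"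
  proof -
    have "(\<Sum>w\<in>Q. ?c w) = (\<Sum>w\<in>Q. \<Sum>v\<in>?N. of_bool ((w, v) \<in> E))"
      using fin by (intro sum.cong) (auto simp: sum_of_bool_eq Int_def Image_def)
    also have "\<dots> = (\<Sum>v\<in>?N. \<Sum>w\<in>Q. of_bool ((w, v) \<in> E))" by (rule sum.swap)
    \<comment> \<open>After double counting, a neighbour of \<open>z\<close> contributes at most 1
      if it is outside \<open>Q\<close> and 3 if it is one of the \<open>k \<le> 1\<close> vertices
      inside.\<close>
    also have "\<dots> \<le> (\<Sum>v\<in>?N. 1 + (if v \<in> Q then 2 else 0))"
    proof (rule sum_mono)
      fix v assume v: "v \<in> ?N"
      have eq: "(\<Sum>w\<in>Q. of_bool ((w, v) \<in> E)) = card {w\<in>Q. (w, v) \<in> E}"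
        using Q4 by (simp add: sum_of_bool_eq Int_def)
      show "(\<Sum>w\<in>Q. of_bool ((w, v) \<in> E)) \<le> 1 + (if v \<in> Q then 2 else 0 :: nat)"
      proof (cases "v \<in> Q")
        case True
        have "card {w\<in>Q. (w, v) \<in> E} \<le> card (Q - {v})"
          using Q4 graph_onD(5)[OF g] by (intro card_mono) auto
        then show ?thesis using True eq Q4 by simp
      next
        case False
        have "card {w\<in>Q. (w, v) \<in> E} \<le> Suc 0"
          using clique4_outside[OF g bf Q False] Q4 graph_onD(4)[OF g]
          by (auto simp: card_le_Suc0_iff_eq dest: symD)
        then show ?thesis using False eq by simp
      qed
    qed
    also have "\<dots> = d + 2 * k"
      unfolding sum.distrib using fin by (simp add: d_def k_def sum.If_cases)
    finally show ?thesis .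
  qed
  moreover have "(\<Sum>w\<in>V - (?N \<union> Q). ?c w) \<le> d * (card V + k - d - 4)"
  proof -
    have "(\<Sum>w\<in>V - (?N \<union> Q). ?c w) \<le> (\<Sum>w\<in>V - (?N \<union> Q). d)"
      unfolding d_def using fin by (intro sum_mono card_mono) auto
    also have "\<dots> = d * (card V - card (?N \<union> Q))"
      using fin Q4 sub by (simp add: card_Diff_subset mult.commute)
    also have "card (?N \<union> Q) + k = d + 4"
      using card_Un_Int[of ?N Q] fin Q4 by (simp add: d_def k_def)
    then have "card V - card (?N \<union> Q) = card V + k - d - 4" by simp
    finally show ?thesis .
  qed
  moreover have "(\<Sum>w\<in>V. ?c w) \<le> (\<Sum>w\<in>?N. ?c w) + (\<Sum>w\<in>Q. ?c w) + (\<Sum>w\<in>V - (?N \<union> Q). ?c w)"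
  proof -
    have "(\<Sum>w\<in>V. ?c w) = (\<Sum>w\<in>V - (?N \<union> Q). ?c w) + (\<Sum>w\<in>?N \<union> Q. ?c w)"
      using sub Q4 fin by (intro sum.subset_diff) auto
    moreover have "(\<Sum>w\<in>?N \<union> Q. ?c w) \<le> (\<Sum>w\<in>?N. ?c w) + (\<Sum>w\<in>Q. ?c w)"
      using fin Q4 by (simp add: sum_Un_nat)
    ultimately show ?thesis by simp
  qed
  ultimately have "(\<Sum>w\<in>V. ?c w) \<le> 2 * (d - 1) + (d + 2 * k) + d * (card V + k - d - 4)" by linarith
  also have "\<dots> \<le> d * (card V - d)"
  proof -
    have "card (?N \<union> Q) \<le> card V" using fin Q4 sub by (intro card_mono) auto
    moreover have "card (?N \<union> Q) + k = d + 4"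
      using card_Un_Int[of ?N Q] fin Q4 by (simp add: d_def k_def)
    ultimately have le: "d + 4 \<le> card V + k" by simp
    define m where "m = card V + k - d - 4"
    have m: "card V - d = m + 4 - k" using le k by (simp add: m_def)
    have "k = 0 \<or> k = 1" using k by auto
    then show ?thesis unfolding m m_def[symmetric] using d by (auto simp: algebra_simps)
  qed
  also have "\<dots> \<le> card V div 2 * (card V - card V div 2)"
    unfolding d_def by (rule mult_diff_le_floor[OF card_mono[OF fin(1) sub]])
  finally show ?thesis .
qed auto

text \<open>The only edges in the neighbourhood of \<open>z\<close> are those of the triangle
  \<open>Q - {z}\<close>, giving at most 6 walks; \<open>d\<close> walks return to \<open>z\<close>;
  every remaining endpoint sees at most one vertex of \<open>Q\<close>, so it receives at most
  \<open>(d - 3) + 1\<close> walks.\<close>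

lemma walks2_le_of_clique4_in:
  assumes g: "graph_on V E" and bf: "bowtie_free E" and n: "card V \<ge> 7"
    and Q: "clique4 E Q" "z \<in> Q"
  shows "(\<Sum>w\<in>V. card (E `` {z} \<inter> E `` {w})) \<le> card V div 2 * (card V - card V div 2) + 2"
proof -
  let ?N = "E `` {z}" and ?c = "\<lambda>w. card (E `` {z} \<inter> E `` {w})"
  note fin = graph_onD(1,6)[OF g] and sub = graph_onD(7)[OF g]
  have sy: "(v, u) \<in> E" if "(u, v) \<in> E" for u v using that graph_onD(4)[OF g] by (auto dest: symD)
  have Q4: "card Q = 4" "finite Q" "Q \<subseteq> V"
    using Q clique4_subset[OF g Q(1)] by (auto simp: clique4_def intro: card_ge_0_finite)
  have edge: "(u, v) \<in> E" if "u \<in> Q" "v \<in> Q" "u \<noteq> v" for u v using that Q by (auto simp: clique4_def)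
  define d where "d = card ?N"
  have NQ: "?N \<inter> Q = Q - {z}" using edge Q(2) graph_onD(5)[OF g] by auto
  have U: "?N \<union> Q = insert z ?N" using NQ Q(2) by blast
  have cU: "card (?N \<union> Q) = d + 1" unfolding U using fin graph_onD(5)[OF g] by (simp add: d_def)
  have dn: "d + 1 \<le> card V" unfolding cU[symmetric] using fin Q4 sub by (intro card_mono) auto
  have cNQ: "card (?N - Q) = d - 3" "d \<ge> 3"
  proof -
    have "card (?N \<inter> Q) = 3" unfolding NQ using Q4 Q(2) by simp
    then show "card (?N - Q) = d - 3" "d \<ge> 3"
      using fin card_Diff_subset_Int[of ?N Q] card_mono[of ?N "?N \<inter> Q"] by (auto simp: d_def)
  qed
  have "(\<Sum>w\<in>Q - {z}. ?c w) \<le> (\<Sum>w\<in>Q - {z}. 2)"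
  proof (rule sum_mono)
    fix w assume w: "w \<in> Q - {z}"
    have "?N \<inter> E `` {w} \<subseteq> Q - {z, w}"
      using clique4_outside[OF g bf Q(1), of _ z w] w Q(2) sy graph_onD(5)[OF g] by fastforce
    then have "?c w \<le> card (Q - {z, w})" using Q4 by (intro card_mono) auto
    also have "\<dots> = 2"
    proof -
      have "z \<noteq> w" using w by blast
      then show ?thesis using Q4 Q(2) w by (simp add: card_Diff_subset)
    qed
    finally show "?c w \<le> 2" .
  qed
  then have s1: "(\<Sum>w\<in>Q - {z}. ?c w) \<le> 6" using Q4 Q(2) by simp
  have s2: "(\<Sum>w\<in>?N - Q. ?c w) = 0"
  proof (rule sum.neutral, rule ballI)
    fix w assume w: "w \<in> ?N - Q"
    have "?N \<inter> E `` {w} = {}"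
    proof (rule ccontr)
      assume "\<not> ?thesis"
      then obtain v where v: "(z, v) \<in> E" "(w, v) \<in> E" by auto
      have "v \<notin> Q" using clique4_outside[OF g bf Q(1), of w z v] w v Q(2) sy graph_onD(5)[OF g] by auto
      have "card (Q - {z}) = 3" using Q4 Q(2) by simp
      then obtain a c e where "Q - {z} = {a, c, e}" "a \<noteq> c" by (auto simp: card_3_iff)
      then have "a \<in> Q" "c \<in> Q" "a \<noteq> z" "c \<noteq> z" "a \<noteq> c" by auto
      then show False
        using bowtie_freeD[OF bf, of z w v a c] w v \<open>v \<notin> Q\<close> edge Q(2) by auto
    qed
    then show "?c w = 0" by simp
  qed
  have "(\<Sum>w\<in>V - (?N \<union> Q). ?c w) \<le> (\<Sum>w\<in>V - (?N \<union> Q). d - 2)"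
  proof (rule sum_mono)
    fix w assume w: "w \<in> V - (?N \<union> Q)"
    have "?N \<inter> E `` {w} \<subseteq> (?N - Q) \<union> (E `` {w} \<inter> Q)" by auto
    then have "?c w \<le> card ((?N - Q) \<union> (E `` {w} \<inter> Q))" using fin by (intro card_mono) auto
    also have "\<dots> \<le> card (?N - Q) + card (E `` {w} \<inter> Q)" by (rule card_Un_le)
    also have "card (E `` {w} \<inter> Q) \<le> Suc 0"
      using clique4_outside[OF g bf Q(1)] w Q4 by (auto simp: card_le_Suc0_iff_eq)
    finally show "?c w \<le> d - 2" using cNQ by linarith
  qed
  also have "\<dots> = (card V - (d + 1)) * (d - 2)"
    using fin Q4 sub cU by (simp add: card_Diff_subset)
  finally have s3: "(\<Sum>w\<in>V - (?N \<union> Q). ?c w) \<le> (card V - (d + 1)) * (d - 2)" .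
  have "(\<Sum>w\<in>V. ?c w) = (\<Sum>w\<in>V - (?N \<union> Q). ?c w) + (\<Sum>w\<in>?N \<union> Q. ?c w)"
    using sub Q4 fin by (intro sum.subset_diff) auto
  also have "(\<Sum>w\<in>?N \<union> Q. ?c w) = (\<Sum>w\<in>?N - Q. ?c w) + (\<Sum>w\<in>Q. ?c w)"
    using fin Q4 by (subst sum.subset_diff[of Q]) (auto intro!: sum.cong)
  also have "(\<Sum>w\<in>Q. ?c w) = d + (\<Sum>w\<in>Q - {z}. ?c w)"
    using Q4 Q(2) by (simp add: sum.remove d_def)
  finally have "(\<Sum>w\<in>V. ?c w) \<le> (card V - (d + 1)) * (d - 2) + (d + 6)" using s1 s2 s3 by linarith
  \<comment> \<open>Rewritten as a product of two numbers with sum \<open>card V - 2\<close>, so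
    that the balanced-product bound applies.\<close>
  also have "\<dots> \<le> (d - 2) * (card V - 2 - (d - 2)) + 8"
  proof -
    define e where "e = d - 3"
    define m where "m = card V - (d + 1)"
    have "d = e + 3" "card V = m + e + 4" using cNQ dn by (auto simp: e_def m_def)
    then show ?thesis by (simp add: algebra_simps)
  qed
  also have "\<dots> \<le> (card V - 2) div 2 * (card V - 2 - (card V - 2) div 2) + 8"
    using mult_diff_le_floor[of "d - 2" "card V - 2"] dn by simp
  \<comment> \<open>Going from \<open>card V - 2\<close> back to \<open>card V\<close> raises the
    balanced product by \<open>card V - 1\<close>, which must cover the surplus 6; this uses
    \<open>card V \<ge> 7\<close>.\<close>
  also have "\<dots> \<le> card V div 2 * (card V - card V div 2) + 2"
  proof -
    define m where "m = card V div 2 - 1"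
    define k where "k = card V - card V div 2 - 1"
    have *: "card V div 2 = m + 1" "card V - card V div 2 = k + 1" "m + k \<ge> 5"
      "(card V - 2) div 2 = m" "card V - 2 - (card V - 2) div 2 = k"
      using n by (auto simp: m_def k_def)
    show ?thesis unfolding *(2,5) unfolding *(1,4) using *(3) by (simp add: algebra_simps)
  qed
  finally show ?thesis .
qed

text \<open>Applying the eigen-equation twice at \<open>z\<close> writes \<open>l^2 * x z\<close> as
  the sum of \<open>x\<close> over the endpoints of all walks of length two from \<open>z\<close>,
  and each entry is at most \<open>x z\<close>.\<close>

lemma lam_sq_le_walks2:
  assumes g: "graph_on V E" and ev: "\<And>u. u \<in> V \<Longrightarrow> nbsum E x u = l * x u"
    and z: "z \<in> V" "x z > 0" "\<And>u. u \<in> V \<Longrightarrow> x u \<le> x z"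
  shows "l\<^sup>2 \<le> real (\<Sum>w\<in>V. card (E `` {z} \<inter> E `` {w}))"
proof -
  note fin = graph_onD(1,6)[OF g] and sub = graph_onD(7)[OF g]
  have "l\<^sup>2 * x z = (\<Sum>v\<in>E `` {z}. l * x v)"
    using ev[OF z(1)] by (simp add: nbsum_def power2_eq_square flip: sum_distrib_left)
  also have "\<dots> = (\<Sum>v\<in>E `` {z}. nbsum E x v)"
    using ev sub[of z] by (intro sum.cong) auto
  also have "\<dots> = (\<Sum>v\<in>E `` {z}. \<Sum>w\<in>V. of_bool ((v, w) \<in> E) * x w)"
    using sub[of z] by (intro sum.cong) (auto simp: sum_of_bool_edges[OF g])
  also have "\<dots> = (\<Sum>w\<in>V. \<Sum>v\<in>E `` {z}. of_bool ((v, w) \<in> E) * x w)" by (rule sum.swap)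
  also have "\<dots> = (\<Sum>w\<in>V. real (card (E `` {z} \<inter> E `` {w})) * x w)"
  proof (rule sum.cong)
    fix w
    have "E `` {z} \<inter> E `` {w} = E `` {z} \<inter> {v. (v, w) \<in> E}"
      using graph_onD(4)[OF g] by (auto dest: symD)
    then show "(\<Sum>v\<in>E `` {z}. of_bool ((v, w) \<in> E) * x w) = real (card (E `` {z} \<inter> E `` {w})) * x w"
      using fin by (simp add: sum_of_bool_eq flip: sum_distrib_right)
  qed simp
  also have "\<dots> \<le> (\<Sum>w\<in>V. real (card (E `` {z} \<inter> E `` {w})) * x z)"
    using z by (intro sum_mono mult_left_mono) auto
  finally have "l\<^sup>2 * x z \<le> real (\<Sum>w\<in>V. card (E `` {z} \<inter> E `` {w})) * x z"
    by (simp add: sum_distrib_right)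
  then show ?thesis using z(2) by simp
qed

section \<open>Reattaching a vertex of an extremal graph\<close>

text \<open>Common form of the modifications applied to an extremal graph: giving \<open>w\<close>
  the neighbourhood of another vertex, making \<open>w\<close> pendant, and exchanging one edge at
  \<open>w\<close>.\<close>

definition reattach :: "('a \<times> 'a) set \<Rightarrow> 'a \<Rightarrow> 'a set \<Rightarrow> ('a \<times> 'a) set" where
  "reattach E w S = (E - {(s, t). s = w \<or> t = w}) \<union> {w} \<times> S \<union> S \<times> {w}"

definition extremal :: "'a set \<Rightarrow> ('a \<times> 'a) set \<Rightarrow> bool" where
  "extremal V E \<longleftrightarrow> graph_on V E \<and> bowtie_free E \<and>
     (\<forall>E'. graph_on V E' \<longrightarrow> bowtie_free E' \<longrightarrow> lam V E' \<le> lam V E)"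

definition kplus :: "'a set \<Rightarrow> 'a set \<Rightarrow> 'a \<Rightarrow> 'a \<Rightarrow> ('a \<times> 'a) set" where
  "kplus A B a b = A \<times> B \<union> B \<times> A \<union> {(a, b), (b, a)}"

lemma graph_on_reattach:
  assumes "graph_on V E" "w \<in> V" "S \<subseteq> V" "w \<notin> S"
  shows "graph_on V (reattach E w S)"
  using assms unfolding graph_on_def reattach_def sym_def by auto

lemma nbsum_reattach_self: "nbsum (reattach E w S) x w = sum x S" if "w \<notin> S"
proof -
  have "reattach E w S `` {w} = S" using that by (auto simp: reattach_def)
  then show ?thesis by (simp add: nbsum_def)
qed

lemma nbsum_reattach:
  assumes g: "graph_on V E" and t: "t \<noteq> w"
  shows "nbsum (reattach E w S) x t
    = nbsum E x t - of_bool (t \<in> E `` {w}) * x w + of_bool (t \<in> S) * x w"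
proof -
  have fin: "finite (E `` {t})" by (rule graph_onD[OF g])
  have "reattach E w S `` {t} = (E `` {t} - {w}) \<union> (if t \<in> S then {w} else {})"
    using t by (auto simp: reattach_def)
  then have "nbsum (reattach E w S) x t = sum x (E `` {t} - {w}) + of_bool (t \<in> S) * x w"
    using fin by (simp add: nbsum_def sum.union_disjoint)
  moreover have "sum x (E `` {t} - {w}) = nbsum E x t - of_bool (t \<in> E `` {w}) * x w"
    using fin graph_onD(4)[OF g] by (auto simp: nbsum_def sum_diff1 dest: symD)
  ultimately show ?thesis by simp
qed

lemma qform_reattach:
  assumes g: "graph_on V E" and w: "w \<in> V" and S: "S \<subseteq> V" "w \<notin> S"
  shows "qform (reattach E w S) x = qform E x + 2 * x w * (sum x S - nbsum E x w)"
proof -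
  note fin = graph_onD(1)[OF g] and N = graph_onD(7)[OF g, of w]
  have sub: "(\<Sum>t\<in>V - {w}. x t * (of_bool (t \<in> T) * x w)) = x w * sum x T"
    if "T \<subseteq> V - {w}" for T
  proof -
    have "(\<Sum>t\<in>V - {w}. x t * (of_bool (t \<in> T) * x w)) = (\<Sum>t\<in>T. x t * (of_bool (t \<in> T) * x w))"
      using fin that by (intro sum.mono_neutral_right) auto
    also have "\<dots> = x w * sum x T" by (simp add: sum_distrib_left mult.commute)
    finally show ?thesis .
  qed
  have "qform (reattach E w S) x
      = x w * sum x S + (\<Sum>t\<in>V - {w}. x t * nbsum (reattach E w S) x t)"
    using w fin by (simp add: qform_eq_nbsum[OF graph_on_reattach[OF assms]] sum.remove[of _ w]
        nbsum_reattach_self[OF S(2)])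
  also have "(\<Sum>t\<in>V - {w}. x t * nbsum (reattach E w S) x t) = (\<Sum>t\<in>V - {w}. x t * nbsum E x t
      - x t * (of_bool (t \<in> E `` {w}) * x w) + x t * (of_bool (t \<in> S) * x w))"
    by (intro sum.cong) (auto simp: nbsum_reattach[OF g] algebra_simps)
  also have "\<dots> = (\<Sum>t\<in>V - {w}. x t * nbsum E x t) - x w * sum x (E `` {w}) + x w * sum x S"
  proof -
    have "E `` {w} \<subseteq> V - {w}" "S \<subseteq> V - {w}" using S N graph_onD(5)[OF g] by auto
    then show ?thesis unfolding sum.distrib sum_subtractf by (simp only: sub)
  qed
  also have "(\<Sum>t\<in>V - {w}. x t * nbsum E x t) = qform E x - x w * nbsum E x w"
    using w fin by (simp add: qform_eq_nbsum[OF g] sum.remove[of _ w])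
  finally show ?thesis by (simp add: nbsum_def algebra_simps)
qed

text \<open>The new graph has a quadratic form at \<open>x\<close> at least as large, so by
  extremality its spectral radius is the same and \<open>x\<close> is an eigenvector of it too.
  Comparing the two eigen-equations gives both conclusions.\<close>

lemma extremal_reattach:
  assumes ex: "extremal V E" and v: "v \<in> V" "x v \<noteq> 0"
    and ev: "\<And>u. u \<in> V \<Longrightarrow> nbsum E x u = lam V E * x u"
    and w: "w \<in> V" "x w \<ge> 0" and S: "S \<subseteq> V" "w \<notin> S" and bf: "bowtie_free (reattach E w S)"
    and ge: "nbsum E x w \<le> sum x S"
  shows "sum x S = lam V E * x w" "x w \<noteq> 0 \<Longrightarrow> S = E `` {w}"
proof -
  have g: "graph_on V E" using ex by (simp add: extremal_def)
  let ?E = "reattach E w S" and ?s = "\<Sum>v\<in>V. (x v)\<^sup>2"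
  have g': "graph_on V ?E" by (rule graph_on_reattach[OF g w(1) S])
  then have le: "lam V ?E \<le> lam V E" using ex bf by (simp add: extremal_def)
  have pos: "?s > 0" using v graph_onD(1)[OF g] by (intro sum_pos2[of _ v]) auto
  have "lam V E * ?s = qform E x"
    unfolding qform_eq_nbsum[OF g] sum_distrib_left
    by (intro sum.cong) (auto simp: ev power2_eq_square)
  also have "\<dots> \<le> qform ?E x"
    unfolding qform_reattach[OF g w(1) S] using w ge by simp
  finally have 1: "lam V E * ?s \<le> qform ?E x" .
  have 2: "qform ?E x \<le> lam V ?E * ?s" using qform_le_lam[OF g'] v by blast
  have "lam V E * ?s \<le> lam V ?E * ?s" using 1 2 by linarith
  then have eq: "lam V ?E = lam V E" using le pos by simp
  with 1 2 have "qform ?E x = lam V ?E * ?s" by simp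
  then have ev': "nbsum ?E x u = lam V E * x u" if "u \<in> V" for u
    using qform_eq_lam_imp_eigen[OF g' _ that] eq by metis
  show "sum x S = lam V E * x w" using ev'[OF w(1)] nbsum_reattach_self[OF S(2)] by metis
  show "S = E `` {w}" if "x w \<noteq> 0"
  proof -
    \<comment> \<open>The old and new neighbour sums at \<open>t\<close> are equal, but would differ
      by \<open>x w\<close> if \<open>t\<close> lay in exactly one of the two sets.\<close>
    have "t \<in> S \<longleftrightarrow> t \<in> E `` {w}" if "t \<in> V" "t \<noteq> w" for t
      using ev'[OF that(1)] ev[OF that(1)] nbsum_reattach[OF g that(2), of S x] \<open>x w \<noteq> 0\<close>
      by (cases "t \<in> S"; cases "t \<in> E `` {w}") auto
    then show ?thesis using S graph_onD(7)[OF g, of w] graph_onD(5)[OF g] by blast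
  qed
qed

text \<open>Folding the twin \<open>w\<close> onto \<open>u\<close> is a homomorphism to the old
  graph. A bowtie can only collapse if its two triangles contain \<open>u\<close> and
  \<open>w\<close> respectively; then the edge from \<open>u\<close> to the image of the centre lies
  in two triangles, so \<open>u\<close> is on a spine.\<close>

lemma bowtie_free_twin:
  assumes g: "graph_on V E" and bf: "bowtie_free E" and u: "\<not> spine E u" "(u, w) \<notin> E" "u \<noteq> w"
  shows "bowtie_free (reattach E w (E `` {u}))"
  unfolding bowtie_free_def
proof (intro allI impI, elim conjE)
  fix a b c d e
  let ?E = "reattach E w (E `` {u})"
  assume E: "(a, b) \<in> ?E" "(a, c) \<in> ?E" "(b, c) \<in> ?E" "(a, d) \<in> ?E" "(a, e) \<in> ?E" "(d, e) \<in> ?E"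
  define \<phi> where "\<phi> v = (if v = w then u else v)" for v
  have sy: "(t, s) \<in> E" if "(s, t) \<in> E" for s t using that graph_onD(4)[OF g] by (auto dest: symD)
  have hom: "(\<phi> s, \<phi> t) \<in> E" if "(s, t) \<in> ?E" for s t
  proof -
    from that consider "s \<noteq> w" "t \<noteq> w" "(s, t) \<in> E" | "s = w" "(u, t) \<in> E" | "t = w" "(u, s) \<in> E"
      unfolding reattach_def by blast
    then show ?thesis
    proof cases
      case 2
      then have "t \<noteq> w" using u(2) by blast
      then show ?thesis using 2 by (simp add: \<phi>_def)
    next
      case 3
      then have "s \<noteq> w" using u(2) by blast
      then show ?thesis using 3 sy by (simp add: \<phi>_def)
    qed (simp add: \<phi>_def)
  qed
  have irr: "(v, v) \<notin> E" for v by (rule graph_onD[OF g])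
  have key: "p = r \<or> q = s"
    if "\<phi> p = \<phi> r" "(a, p) \<in> ?E" "(a, q) \<in> ?E" "(p, q) \<in> ?E" "(a, r) \<in> ?E" "(a, s) \<in> ?E" "(r, s) \<in> ?E"
    for p q r s
  proof (rule ccontr)
    assume ne: "\<not> ?thesis"
    then have pu: "\<phi> p = u" using that(1) by (auto simp: \<phi>_def split: if_splits)
    have E': "(\<phi> a, \<phi> p) \<in> E" "(\<phi> a, \<phi> q) \<in> E" "(\<phi> p, \<phi> q) \<in> E" "(\<phi> a, \<phi> s) \<in> E" "(\<phi> r, \<phi> s) \<in> E"
      using that hom by blast+
    have "\<phi> q \<noteq> u" "\<phi> s \<noteq> u" using E'(3,5) pu that(1) irr by auto
    then have "\<phi> q \<noteq> \<phi> s" using ne by (auto simp: \<phi>_def split: if_splits)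
    then have "spine E u"
      unfolding spine_def using E' pu that(1) sy by metis
    then show False using u by simp
  qed
  have sy': "(t, s) \<in> ?E" if "(s, t) \<in> ?E" for s t using that sy by (auto simp: reattach_def)
  have "\<phi> b = \<phi> d \<or> \<phi> b = \<phi> e \<or> \<phi> c = \<phi> d \<or> \<phi> c = \<phi> e"
    using bowtie_freeD[OF bf] E hom by blast
  then show "b = d \<or> b = e \<or> c = d \<or> c = e"
    using key[of b d c e] key[of b e c d] key[of c d b e] key[of c e b d] E sy' by blast
qed

text \<open>A pendant vertex lies in no triangle, so all triangles are old ones.\<close>

lemma bowtie_free_pendant:
  assumes g: "graph_on V E" and bf: "bowtie_free E" and "w \<noteq> z"
  shows "bowtie_free (reattach E w {z})"
  unfolding bowtie_free_def
proof (intro allI impI, elim conjE)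
  fix a b c d e
  let ?E = "reattach E w {z}"
  assume E: "(a, b) \<in> ?E" "(a, c) \<in> ?E" "(b, c) \<in> ?E" "(a, d) \<in> ?E" "(a, e) \<in> ?E" "(d, e) \<in> ?E"
  have irr: "(v, v) \<notin> E" for v by (rule graph_onD[OF g])
  have tri: "(p, q) \<in> E \<and> (p, r) \<in> E \<and> (q, r) \<in> E"
    if "(p, q) \<in> ?E" "(p, r) \<in> ?E" "(q, r) \<in> ?E" for p q r
    using that irr assms(3) by (auto simp: reattach_def)
  show "b = d \<or> b = e \<or> c = d \<or> c = e"
    using bowtie_freeD[OF bf] tri[OF E(1-3)] tri[OF E(4-6)] by blast
qed

lemma bowtie_free_subset: "bowtie_free E \<Longrightarrow> E' \<subseteq> E \<Longrightarrow> bowtie_free E'"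
  unfolding bowtie_free_def by blast

text \<open>Every triangle contains both \<open>a\<close> and \<open>b\<close>, so two triangles
  with a common vertex share another one.\<close>

lemma bowtie_free_kplus:
  assumes "A \<inter> B = {}" "a \<in> A" "b \<in> A" "a \<noteq> b"
  shows "bowtie_free (kplus A B a b)"
  unfolding bowtie_free_def
proof (intro allI impI, elim conjE)
  fix v p q r s
  let ?E = "kplus A B a b"
  assume E: "(v, p) \<in> ?E" "(v, q) \<in> ?E" "(p, q) \<in> ?E" "(v, r) \<in> ?E" "(v, s) \<in> ?E" "(r, s) \<in> ?E"
  have tri: "a \<in> {v, p, q} \<and> b \<in> {v, p, q}" if "(v, p) \<in> ?E" "(v, q) \<in> ?E" "(p, q) \<in> ?E" for v p q
    using that assms unfolding kplus_def by blast
  show "p = r \<or> p = s \<or> q = r \<or> q = s"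
    using tri[OF E(1-3)] tri[OF E(4-6)] assms(4) by blast
qed

lemma graph_on_kplus:
  assumes "finite A" "finite B" "A \<inter> B = {}" "a \<in> A" "b \<in> A" "a \<noteq> b"
  shows "graph_on (A \<union> B) (kplus A B a b)"
  using assms by (auto simp: graph_on_def kplus_def sym_def)

text \<open>If \<open>x w = 0\<close>, hanging \<open>w\<close> as a pendant vertex on
  \<open>z\<close> leaves the quadratic form at \<open>x\<close> unchanged; the eigen-equation at
  \<open>w\<close> in the new graph then gives \<open>x z = 0\<close>.\<close>

lemma extremal_eigenvector_pos:
  assumes ex: "extremal V E" and nn: "\<And>v. x v \<ge> 0" and z: "z \<in> V" "x z > 0"
    and ev: "\<And>u. u \<in> V \<Longrightarrow> nbsum E x u = lam V E * x u" and w: "w \<in> V"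
  shows "x w > 0"
proof (rule ccontr)
  assume "\<not> ?thesis"
  then have xw: "x w = 0" using nn[of w] by simp
  then have ne: "w \<noteq> z" using z by auto
  have "bowtie_free (reattach E w {z})"
    using bowtie_free_pendant[OF _ _ ne] ex by (auto simp: extremal_def)
  then have "sum x {z} = lam V E * x w"
    using z ne nn ev[OF w] xw by (intro extremal_reattach(1)[OF ex, of z x w "{z}"] ev w) auto
  then show False using xw z by simp
qed

text \<open>Zykov symmetrization: the neighbour sum at \<open>u\<close> is
  \<open>lam V E * x u\<close>, at least that at \<open>w\<close>, so turning \<open>w\<close> into
  a twin of \<open>u\<close> does not lower the quadratic form.\<close>

lemma extremal_twin:
  assumes ex: "extremal V E" and pos: "\<And>v. v \<in> V \<Longrightarrow> x v > 0" and nn: "lam V E \<ge> 0"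
    and ev: "\<And>u. u \<in> V \<Longrightarrow> nbsum E x u = lam V E * x u"
    and u: "u \<in> V" "w \<in> V" "(u, w) \<notin> E" "\<not> spine E u" "x w \<le> x u"
  shows "E `` {u} = E `` {w}"
proof (cases "u = w")
  case False
  have g: "graph_on V E" "bowtie_free E" using ex by (auto simp: extremal_def)
  have bf: "bowtie_free (reattach E w (E `` {u}))"
    by (rule bowtie_free_twin[OF g u(4,3) False])
  have "nbsum E x w \<le> sum x (E `` {u})"
    using ev[OF u(1)] ev[OF u(2)] u(5) nn unfolding nbsum_def[of E x u] by (simp add: mult_left_mono)
  moreover have "w \<notin> E `` {u}" using u(3) by simp
  moreover have "E `` {u} \<subseteq> V" by (rule graph_onD[OF g(1)])
  moreover have "0 \<le> x w" "x w \<noteq> 0" "x u \<noteq> 0" using pos[OF u(1)] pos[OF u(2)] by auto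
  ultimately show ?thesis
    using extremal_reattach(2)[OF ex u(1) _ ev u(2) _ _ _ bf] by blast
qed simp

section \<open>Structure of extremal graphs\<close>

text \<open>If a page \<open>c\<close> of the book on \<open>wa\<close> were on a spine, some
  triangle \<open>c r y\<close> would have \<open>r\<close> in \<open>{w, a}\<close> and
  \<open>y\<close> outside. At centre \<open>r\<close> it forms a bowtie with the triangle
  \<open>r r' d\<close>, where \<open>r'\<close> is the other one of \<open>w\<close>,
  \<open>a\<close>, unless \<open>y = d\<close>; but then \<open>w\<close>, \<open>a\<close>,
  \<open>c\<close>, \<open>d\<close> form a \<open>K4\<close>.\<close>

lemma page_not_spine:
  assumes g: "graph_on V E" and bf: "bowtie_free E" and k4: "\<And>Q. \<not> clique4 E Q"
    and e: "(w, a) \<in> E" "(w, c) \<in> E" "(w, d) \<in> E" "(a, c) \<in> E" "(a, d) \<in> E" "c \<noteq> d"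
  shows "\<not> spine E c"
proof
  assume "spine E c"
  then obtain s p q where s: "p \<noteq> q" "(c, s) \<in> E" "(c, p) \<in> E" "(c, q) \<in> E" "(s, p) \<in> E" "(s, q) \<in> E"
    unfolding spine_def by blast
  have sy: "(v, u) \<in> E" if "(u, v) \<in> E" for u v using that graph_onD(4)[OF g] by (auto dest: symD)
  have irr: "(v, v) \<notin> E" for v by (rule graph_onD[OF g])
  have "\<exists>r y. r \<in> {w, a} \<and> y \<noteq> w \<and> y \<noteq> a \<and> (c, y) \<in> E \<and> (r, y) \<in> E"
  proof (cases "s = w \<or> s = a")
    case True
    have "p \<noteq> s" "q \<noteq> s" using s irr by auto
    then have "(p \<noteq> w \<and> p \<noteq> a) \<or> (q \<noteq> w \<and> q \<noteq> a)" using s(1) True by auto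
    then show ?thesis using True s by blast
  next
    case False
    have "p = w \<or> p = a" using bowtie_freeD[OF bf, of c w a s p] e s sy False by auto
    then show ?thesis using False s sy by blast
  qed
  then obtain r y where y: "r \<in> {w, a}" "y \<noteq> w" "y \<noteq> a" "(c, y) \<in> E" "(r, y) \<in> E" by blast
  define r' where "r' = (if r = w then a else w)"
  have r: "(r, r') \<in> E" "(r, d) \<in> E" "(r', d) \<in> E" "(r, c) \<in> E" "(r', c) \<in> E" "r' \<noteq> y"
    using y e sy by (auto simp: r'_def)
  have "r' \<noteq> c" using r irr by auto
  then have "y = d" using bowtie_freeD[OF bf, of r c y r' d] r y sy e(6) by auto
  then have "(c, d) \<in> E" using y by simp
  then show False using clique4I[OF g, of w a c d] e k4 by blast
qed

lemma extremal_structure: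
  assumes ex: "extremal V E" and n: "card V \<ge> 7"
    and big: "(lam V E)\<^sup>2 > real (card V div 2 * (card V - card V div 2) + 2)" and nn: "lam V E \<ge> 0"
  shows "\<exists>A a b. A \<subseteq> V \<and> a \<in> A \<and> b \<in> A \<and> a \<noteq> b \<and> E = kplus A (V - A) a b"
proof -
  have g: "graph_on V E" and bf: "bowtie_free E" using ex by (auto simp: extremal_def)
  note fin = graph_onD(1)[OF g] and EV = graph_onD(3)[OF g]
  have sy: "(v, u) \<in> E" if "(u, v) \<in> E" for u v using that graph_onD(4)[OF g] by (auto dest: symD)
  have irr: "(v, v) \<notin> E" for v by (rule graph_onD[OF g])
  have "V \<noteq> {}" using n by auto
  from ex_nonneg_eigenvector[OF g this] obtain x where x: "\<And>v. x v \<ge> 0" "\<exists>v\<in>V. x v > 0"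
    and ev: "\<And>u. u \<in> V \<Longrightarrow> nbsum E x u = lam V E * x u" by blast
  have pos: "x w > 0" if "w \<in> V" for w
    using extremal_eigenvector_pos[OF ex x(1) _ _ ev that] x(2) by blast
  have "Max (x ` V) \<in> x ` V" using fin \<open>V \<noteq> {}\<close> by (intro Max_in) auto
  then obtain z where z: "z \<in> V" "x z = Max (x ` V)" by auto
  have zmax: "x u \<le> x z" if "u \<in> V" for u using that fin by (simp add: z(2))
  have walks: "card V div 2 * (card V - card V div 2) + 2 < (\<Sum>w\<in>V. card (E `` {z} \<inter> E `` {w}))"
    using lam_sq_le_walks2[OF g ev z(1) pos[OF z(1)] zmax] big by linarith
  have spz: "spine E z" using walks2_le_of_not_spine[OF g bf, of z] walks by auto
  \<comment> \<open>One of the two clique bounds applies according to whether some \<open>K4\<close>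
    contains \<open>z\<close>; both contradict \<open>walks\<close>.\<close>
  have k4: "\<not> clique4 E Q" for Q
    using walks2_le_of_clique4_notin[OF g bf _, of z Q] walks2_le_of_clique4_in[OF g bf n, of _ z] walks
    by (meson add_leD1 leD order_trans le_add1)
  have twin: "E `` {u} = E `` {w}"
    if "u \<in> V" "w \<in> V" "(u, w) \<notin> E" "\<not> spine E u" "\<not> spine E w" for u w
  proof (cases "x w \<le> x u")
    case True
    then show ?thesis using extremal_twin[OF ex pos nn ev] that by blast
  next
    case False
    then show ?thesis using extremal_twin[OF ex pos nn ev, of w u] that sy by fastforce
  qed
  obtain b p0 p1 where b: "p0 \<noteq> p1" "(z, b) \<in> E" "(z, p0) \<in> E" "(z, p1) \<in> E" "(b, p0) \<in> E" "(b, p1) \<in> E"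
    using spz unfolding spine_def by blast
  have inV: "u \<in> V" "v \<in> V" if "(u, v) \<in> E" for u v using that EV by auto
  have spb: "spine E b" unfolding spine_def using b sy by blast
  have zb: "z \<noteq> b" using b irr by auto
  define P where "P = {p. (z, p) \<in> E \<and> (b, p) \<in> E}"
  have P01: "p0 \<in> P" "p1 \<in> P" using b by (auto simp: P_def)
  \<comment> \<open>A second page is needed to apply \<open>page_not_spine\<close>;
    \<open>p0\<close> or \<open>p1\<close> serves.\<close>
  have Pns: "\<not> spine E p" if "p \<in> P" for p
  proof -
    obtain q where "q \<in> P" "q \<noteq> p" using P01 b(1) by metis
    then show ?thesis using page_not_spine[OF g bf k4 b(2), of p q] that by (auto simp: P_def)
  qed
  have PP: "(p, q) \<notin> E" if "p \<in> P" "q \<in> P" for p q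
    using that clique4I[OF g b(2), of p q] k4 by (auto simp: P_def)
  have NP: "E `` {p} = E `` {p0}" if "p \<in> P" for p
  proof (rule twin)
    show "p \<in> V" "p0 \<in> V" using that P01 inV unfolding P_def by blast+
  qed (use that P01 Pns PP in auto)
  define D where "D = E `` {p0} - {z, b}"
  have zp: "z \<notin> P" "b \<notin> P" using irr by (auto simp: P_def)
  \<comment> \<open>Otherwise the triangles \<open>z p0 d\<close> and \<open>z b p1\<close> form a
    bowtie at \<open>z\<close>, and symmetrically at \<open>b\<close>; \<open>d\<close> is not
    \<open>p1\<close> because pages are non-adjacent.\<close>
  have Dz: "(z, d) \<notin> E" "(b, d) \<notin> E" if "d \<in> D" for d
  proof -
    have d: "(p0, d) \<in> E" "d \<noteq> z" "d \<noteq> b" using that by (auto simp: D_def)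
    have "d \<noteq> p1" "b \<noteq> p0" "b \<noteq> p1" "z \<noteq> p0" "z \<noteq> p1" using d PP P01 zp by auto
    then show "(z, d) \<notin> E" "(b, d) \<notin> E"
      using bowtie_freeD[OF bf, of z p0 d b p1] bowtie_freeD[OF bf, of b p0 d z p1] d b b(1) sy[OF b(2)]
      by auto
  qed
  \<comment> \<open>An edge inside \<open>D\<close> would give triangles \<open>p0 d d'\<close> and
    \<open>p0 z b\<close>.\<close>
  have DD: "(d, d') \<notin> E" if "d \<in> D" "d' \<in> D" for d d'
    using bowtie_freeD[OF bf, of p0 d d' z b] that b sy by (auto simp: D_def)
  define R where "R = V - P - D - {z, b}"
  have PR: "(p, w) \<notin> E" if "p \<in> P" "w \<in> R" for p w
    using NP[OF that(1)] that(2) by (auto simp: R_def D_def)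
  have PD: "(p, d) \<in> E" if "p \<in> P" "d \<in> D" for p d
    using NP[OF that(1)] that(2) by (auto simp: D_def)
  \<comment> \<open>A vertex of \<open>R\<close> on no spine would be a twin of the page
    \<open>p0\<close>, hence adjacent to \<open>z\<close> and \<open>b\<close> and itself a
    page.\<close>
  have spR: "spine E w" if w: "w \<in> R" for w
  proof (rule ccontr)
    assume "\<not> ?thesis"
    have "E `` {p0} = E `` {w}"
    proof (rule twin)
      show "p0 \<in> V" "w \<in> V" using w b(3) inV by (auto simp: R_def)
      show "(p0, w) \<notin> E" by (rule PR[OF P01(1) w])
    qed (use \<open>\<not> spine E w\<close> P01 Pns in auto)
    moreover have "z \<in> E `` {p0}" "b \<in> E `` {p0}" using b sy by auto
    ultimately have "(w, z) \<in> E" "(w, b) \<in> E" by auto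
    then have "w \<in> P" using sy by (auto simp: P_def)
    then show False using w by (simp add: R_def)
  qed
  have cases: "v \<in> P \<or> v \<in> D \<or> v \<in> R \<or> v = z \<or> v = b" if "v \<in> V" for v using that by (auto simp: R_def)
  \<comment> \<open>A page \<open>c\<close> of a book at \<open>w\<close> is on no spine and is not
    in \<open>P\<close>, which leaves only \<open>D\<close>. The spine partner \<open>a\<close> is
    adjacent to \<open>c\<close> and to \<open>w\<close>, which excludes \<open>D\<close>,
    \<open>z\<close>, \<open>b\<close> and \<open>P\<close>.\<close>
  have Rbook: "\<exists>a\<in>R. \<exists>c\<in>D. (w, a) \<in> E \<and> (w, c) \<in> E \<and> (a, c) \<in> E \<and> \<not> spine E c" if w: "w \<in> R" for w
  proof -
    obtain a c e where e: "c \<noteq> e" "(w, a) \<in> E" "(w, c) \<in> E" "(w, e) \<in> E" "(a, c) \<in> E" "(a, e) \<in> E"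
      using spR[OF w] unfolding spine_def by blast
    have nc: "\<not> spine E c" by (rule page_not_spine[OF g bf k4 e(2,3,4,5,6,1)])
    have cD: "c \<in> D"
      using cases[OF inV(2)[OF e(3)]] nc spz spb spR PR[OF _ w] sy[OF e(3)] by blast
    have "a \<in> R"
      using cases[OF inV(2)[OF e(2)]] DD[OF _ cD] Dz[OF cD] e(5) PR[OF _ w] sy[OF e(2)] by blast
    then show ?thesis using e cD nc by blast
  qed
  have PVs: "P \<subseteq> V" "D \<subseteq> V" "R \<subseteq> V" "b \<in> V" using inV b by (auto simp: P_def D_def R_def)
  have disj: "P \<inter> D = {}" using PP P01 by (auto simp: D_def)
  \<comment> \<open>The graph sits inside a copy of K^+ except for edges within
    \<open>R\<close>.\<close>
  have edge: "(u, v) \<in> kplus (D \<union> {z, b}) (P \<union> R) z b \<or> (u \<in> R \<and> v \<in> R)" if "(u, v) \<in> E" for u v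
  proof -
    have "u \<noteq> v" using that irr by auto
    then show ?thesis
      using cases[OF inV(1)[OF that]] cases[OF inV(2)[OF that]] that sy[OF that] PP PR Dz DD
      unfolding kplus_def by blast
  qed
  have "R = {}"
  proof (rule ccontr)
    assume "R \<noteq> {}"
    then obtain w a c where w: "w \<in> R" "a \<in> R" "c \<in> D" "(w, a) \<in> E" "(w, c) \<in> E" "(a, c) \<in> E" "\<not> spine E c"
      using Rbook by blast
    \<comment> \<open>A further \<open>w'\<close> brings an edge \<open>w' a'\<close> and a page
      \<open>c'\<close> which is a twin of \<open>c\<close>. Both edges then span triangles with
      \<open>c\<close>: if they are disjoint this is a bowtie, and if they meet then
      \<open>c\<close> is on a spine.\<close>
    have Req: "w' = w \<or> w' = a" if w': "w' \<in> R" for w'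
    proof (rule ccontr)
      assume ne: "\<not> ?thesis"
      obtain a' c' where c': "a' \<in> R" "c' \<in> D" "(w', a') \<in> E" "(w', c') \<in> E" "(a', c') \<in> E" "\<not> spine E c'"
        using Rbook[OF w'] by blast
      have "E `` {c} = E `` {c'}" using twin[of c c'] w c' DD PVs by blast
      then have e: "(c, w) \<in> E" "(c, a) \<in> E" "(c, w') \<in> E" "(c, a') \<in> E" using w c' sy by blast+
      then have "a' = w \<or> a' = a" using bowtie_freeD[OF bf, of c w a w' a'] w(4) c'(3) ne by blast
      then have "spine E c"
        unfolding spine_def using e w(4) c'(3) ne sy by blast
      then show False using w by simp
    qed
    \<comment> \<open>Otherwise the triangles \<open>z w a\<close> and \<open>z b p0\<close> form a
      bowtie at \<open>z\<close>.\<close>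
    have "(z, w) \<notin> E \<or> (z, a) \<notin> E"
      using bowtie_freeD[OF bf, of z w a b p0] w b P01 by (auto simp: R_def)
    then obtain s t where st: "s \<in> R" "t \<in> R" "(z, s) \<notin> E" "(s, t) \<in> E" "\<And>r. r \<in> R \<Longrightarrow> r = s \<or> r = t"
      using w Req sy by blast
    \<comment> \<open>exchange the edge \<open>st\<close> for \<open>sz\<close>\<close>
    define S where "S = insert z (E `` {s} - {t})"
    have sz: "s \<in> V" "s \<noteq> z" "t \<in> V" using st by (auto simp: R_def)
    have S: "S \<subseteq> V" "s \<notin> S" using sz z inV irr by (auto simp: S_def)
    \<comment> \<open>The removed edge \<open>st\<close> was the only one within \<open>R\<close>,
      so everything left, including the new edge \<open>sz\<close>, fits into K^+.\<close>
    have "reattach E s S \<subseteq> kplus (D \<union> {z, b}) (P \<union> R) z b"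
    proof (rule subrelI)
      fix u v assume "(u, v) \<in> reattach E s S"
      then consider "(u, v) \<in> E" "u \<noteq> s" "v \<noteq> s" | "u = s" "v \<in> S" | "v = s" "u \<in> S"
        by (auto simp: reattach_def)
      then show "(u, v) \<in> kplus (D \<union> {z, b}) (P \<union> R) z b"
      proof cases
        case 1
        then show ?thesis using edge[OF 1(1)] st(5) irr by blast
      next
        case 2
        then show ?thesis using edge[of s v] st irr by (auto simp: S_def kplus_def)
      next
        case 3
        then show ?thesis using edge[of s u] st irr by (auto simp: S_def kplus_def)
      qed
    qed
    moreover have "bowtie_free (kplus (D \<union> {z, b}) (P \<union> R) z b)"
      using disj zp zb by (intro bowtie_free_kplus) (auto simp: R_def)
    ultimately have bf': "bowtie_free (reattach E s S)" using bowtie_free_subset by blast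
    have fs: "finite (E `` {s})" by (rule graph_onD[OF g])
    have "nbsum E x s = sum x (E `` {s} - {t}) + x t"
      unfolding nbsum_def using fs st(4) by (subst sum.remove[of _ t]) auto
    moreover have "sum x S = sum x (E `` {s} - {t}) + x z"
      unfolding S_def using fs st(3) sy by (subst sum.insert) auto
    ultimately have "nbsum E x s \<le> sum x S" using zmax[OF sz(3)] by simp
    then have "S = E `` {s}"
      using extremal_reattach(2)[OF ex z(1) _ ev sz(1) _ S bf'] pos[OF z(1)] pos[OF sz(1)] by force
    then show False using st(3) sy by (auto simp: S_def)
  qed
  have VA: "V - (D \<union> {z, b}) = P"
    using cases \<open>R = {}\<close> PVs disj zp by blast
  have "E = kplus (D \<union> {z, b}) P z b"
  proof (intro equalityI subrelI)
    fix u v assume "(u, v) \<in> E"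
    then show "(u, v) \<in> kplus (D \<union> {z, b}) P z b" using edge[of u v] \<open>R = {}\<close> by simp
  next
    fix u v assume "(u, v) \<in> kplus (D \<union> {z, b}) P z b"
    moreover have "(d, p) \<in> E" if "d \<in> D \<union> {z, b}" "p \<in> P" for d p
      using that PD sy unfolding P_def by blast
    ultimately show "(u, v) \<in> E" using b(2) sy unfolding kplus_def by blast
  qed
  moreover have "D \<union> {z, b} \<subseteq> V" "z \<in> D \<union> {z, b}" "b \<in> D \<union> {z, b}" using PVs z(1) by auto
  ultimately show ?thesis using VA zb by metis
qed

section \<open>Balancing the parts\<close>

lemma sum_two_points:
  fixes f :: "'a \<Rightarrow> real"
  assumes "finite A" "a \<in> A" "b \<in> A" "a \<noteq> b" "\<And>c. c \<in> A \<Longrightarrow> c \<noteq> a \<Longrightarrow> c \<noteq> b \<Longrightarrow> f c = r"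
  shows "sum f A = f a + f b + (real (card A) - 2) * r"
proof -
  have "sum f A = f a + (f b + sum f (A - {a} - {b}))"
    using assms sum.remove[of A a f] sum.remove[of "A - {a}" b f] by simp
  also have "sum f (A - {a} - {b}) = (\<Sum>c\<in>A - {a} - {b}. r)"
    using assms by (intro sum.cong) auto
  also have "\<dots> = real (card (A - {a} - {b})) * r" by simp
  also have "card (A - {a} - {b}) = card A - 2" using assms by simp
  also have "real (card A - 2) = real (card A) - 2"
  proof -
    have "card {a, b} \<le> card A" using assms by (intro card_mono) auto
    then show ?thesis using assms(4) by simp
  qed
  finally show ?thesis by simp
qed

lemma nbsum_kplus:
  assumes "finite A" "finite B" "A \<inter> B = {}" "a \<in> A" "b \<in> A" "a \<noteq> b"
  shows "v \<in> B \<Longrightarrow> nbsum (kplus A B a b) x v = sum x A"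
    "nbsum (kplus A B a b) x a = x b + sum x B"
    "nbsum (kplus A B a b) x b = x a + sum x B"
    "c \<in> A \<Longrightarrow> c \<noteq> a \<Longrightarrow> c \<noteq> b \<Longrightarrow> nbsum (kplus A B a b) x c = sum x B"
proof -
  have "kplus A B a b `` {v} = A" if "v \<in> B" for v using that assms by (auto simp: kplus_def)
  moreover have "kplus A B a b `` {a} = insert b B" "kplus A B a b `` {b} = insert a B"
    using assms by (auto simp: kplus_def)
  moreover have "kplus A B a b `` {c} = B" if "c \<in> A" "c \<noteq> a" "c \<noteq> b" for c
    using that assms by (auto simp: kplus_def)
  moreover have "a \<notin> B" "b \<notin> B" using assms by auto
  ultimately show "v \<in> B \<Longrightarrow> nbsum (kplus A B a b) x v = sum x A"
    "nbsum (kplus A B a b) x a = x b + sum x B"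
    "nbsum (kplus A B a b) x b = x a + sum x B"
    "c \<in> A \<Longrightarrow> c \<noteq> a \<Longrightarrow> c \<noteq> b \<Longrightarrow> nbsum (kplus A B a b) x c = sum x B"
    using assms(1,2) by (auto simp: nbsum_def)
qed

text \<open>Says that \<open>l\<close> is a root of the characteristic polynomial of the quotient
  matrix for the classes \<open>{a, b}\<close>, \<open>A - {a, b}\<close> and \<open>V - A\<close>.
  It follows by eliminating the entries of an eigenvector in terms of its sum
  \<open>\<sigma>\<close> over \<open>V - A\<close>.\<close>

lemma lam_kplus_eq:
  assumes V: "finite V" "A \<subseteq> V" "a \<in> A" "b \<in> A" "a \<noteq> b" and l: "lam V (kplus A (V - A) a b) = l" "l > 1"
  shows "l\<^sup>2 * (l - 1) = real (card (V - A)) * (real (card A) * (l - 1) + 2)"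
proof -
  define B where "B = V - A"
  have fin: "finite A" "finite B" "A \<inter> B = {}" "V = A \<union> B"
    using V by (auto simp: B_def intro: finite_subset)
  note nb = nbsum_kplus[OF fin(1-3) V(3-5)]
  have g: "graph_on V (kplus A B a b)" using graph_on_kplus[OF fin(1-3) V(3-5)] fin(4) by simp
  have "V \<noteq> {}" using V by auto
  from ex_nonneg_eigenvector[OF g this] obtain x where x: "\<And>v. x v \<ge> 0" "\<exists>v\<in>V. x v > 0"
    and ev: "\<And>u. u \<in> V \<Longrightarrow> nbsum (kplus A B a b) x u = l * x u" using l(1) unfolding B_def by blast
  define \<sigma> where "\<sigma> = sum x B"
  have c: "l * x c = \<sigma>" if "c \<in> A" "c \<noteq> a" "c \<noteq> b" for c
    using ev[of c] nb(4)[OF that] that(1) fin(4) by (simp add: \<sigma>_def)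
  have a: "l * x a = x b + \<sigma>" "l * x b = x a + \<sigma>"
    using ev[of a] ev[of b] nb V fin(4) by (auto simp: \<sigma>_def)
  have v: "l * x v = sum x A" if "v \<in> B" for v using ev[of v] nb(1)[of v] that fin(4) by auto
  have "(l + 1) * (x a - x b) = 0" using a by (simp add: algebra_simps)
  then have ab: "x a = x b" using l by auto
  then have s: "(l - 1) * x a = \<sigma>" using a by (simp add: algebra_simps)
  have lA: "l * sum x A = 2 * l * x a + (real (card A) - 2) * \<sigma>"
    using sum_two_points[OF fin(1) V(3-5), of "\<lambda>c. l * x c" \<sigma>] c ab
    by (simp add: sum_distrib_left)
  have lB: "l * \<sigma> = real (card B) * sum x A"
  proof -
    have "l * \<sigma> = (\<Sum>v\<in>B. l * x v)" by (simp add: \<sigma>_def sum_distrib_left)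
    also have "\<dots> = (\<Sum>v\<in>B. sum x A)" using v by (intro sum.cong) auto
    finally show ?thesis by simp
  qed
  \<comment> \<open>All entries vanish if \<open>\<sigma>\<close> does, so it may be
    cancelled.\<close>
  have "\<sigma> \<noteq> 0"
  proof
    assume "\<sigma> = 0"
    then have "x a = 0" "x b = 0" using s ab l by auto
    moreover have "x v = 0" if "v \<in> B" for v
      using \<open>\<sigma> = 0\<close> that fin x(1) unfolding \<sigma>_def by (simp add: sum_nonneg_eq_0_iff)
    moreover have "x c = 0" if "c \<in> A" "c \<noteq> a" "c \<noteq> b" for c using c[OF that] \<open>\<sigma> = 0\<close> l by simp
    ultimately have "\<forall>v\<in>V. x v = 0" using fin(4) by auto
    then show False using x(2) by auto
  qed
  moreover have "l\<^sup>2 * (l - 1) * \<sigma> = real (card B) * (real (card A) * (l - 1) + 2) * \<sigma>"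
  proof -
    have "l\<^sup>2 * (l - 1) * \<sigma> = (l - 1) * l * (l * \<sigma>)" by (simp add: power2_eq_square)
    also have "\<dots> = real (card B) * (l - 1) * (l * sum x A)" unfolding lB by simp
    also have "\<dots> = real (card B) * (2 * l * ((l - 1) * x a) + (l - 1) * (real (card A) - 2) * \<sigma>)"
      unfolding lA by (simp add: algebra_simps)
    also have "\<dots> = real (card B) * (real (card A) * (l - 1) + 2) * \<sigma>"
      unfolding s by (simp add: algebra_simps)
    finally show ?thesis .
  qed
  ultimately show ?thesis by (simp add: B_def)
qed

text \<open>The test vector satisfies the eigen-equation for \<open>m\<close> exactly on
  \<open>A\<close>; the hypothesis on \<open>m\<close> says that on \<open>V - A\<close> the
  neighbour sum exceeds \<open>m\<close> times the entry. Hence the Rayleigh quotient exceeds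
  \<open>m\<close>.\<close>

lemma lam_kplus_gt:
  assumes V: "finite V" "A \<subseteq> V" "a \<in> A" "b \<in> A" "a \<noteq> b" and m: "m > 1"
    and lt: "m\<^sup>2 * (m - 1) < real (card (V - A)) * (real (card A) * (m - 1) + 2)"
  shows "m < lam V (kplus A (V - A) a b)"
proof -
  define B where "B = V - A"
  have fin: "finite A" "finite B" "A \<inter> B = {}" "V = A \<union> B"
    using V by (auto simp: B_def intro: finite_subset)
  note nb = nbsum_kplus[OF fin(1-3) V(3-5)]
  have g: "graph_on V (kplus A B a b)" using graph_on_kplus[OF fin(1-3) V(3-5)] fin(4) by simp
  have "V \<noteq> {}" using V by auto
  define q where "q = real (card B)"
  \<comment> \<open>the shape of the Perron vector of \<open>K\<^sup>+\<close>, with \<open>m\<close> in place of the eigenvalue\<close>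
  define x where "x v = (if v \<in> B then 1 else if v = a \<or> v = b then q / (m - 1) else q / m)" for v
  have xs: "\<And>v. v \<in> B \<Longrightarrow> x v = 1" "x a = q / (m - 1)" "x b = q / (m - 1)"
    "\<And>c. c \<in> A \<Longrightarrow> c \<noteq> a \<Longrightarrow> c \<noteq> b \<Longrightarrow> x c = q / m"
    using V fin by (auto simp: x_def)
  have sB: "sum x B = q" by (simp add: xs(1) q_def)
  have A: "nbsum (kplus A B a b) x c = m * x c" if "c \<in> A" for c
  proof (cases "c = a \<or> c = b")
    case True
    have "nbsum (kplus A B a b) x c = q / (m - 1) + q" using True nb(2,3) xs sB by auto
    also have "\<dots> = m * (q / (m - 1))" using m by (simp add: field_simps)
    finally show ?thesis using True xs by auto
  next
    case False
    then show ?thesis using nb(4)[of c] that xs(4)[of c] sB m by simp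
  qed
  have sA: "sum x A = 2 * q / (m - 1) + (real (card A) - 2) * (q / m)"
    using sum_two_points[OF fin(1) V(3-5), of x "q / m"] xs by simp
  have "m * (m - 1) * sum x A = q * (real (card A) * (m - 1) + 2)"
  proof -
    have "m * (m - 1) * (2 * q / (m - 1)) = 2 * q * m"
      "m * (m - 1) * ((real (card A) - 2) * (q / m)) = (m - 1) * (real (card A) - 2) * q"
      using m by (auto simp: field_simps)
    then show ?thesis unfolding sA distrib_left by (simp add: algebra_simps)
  qed
  then have "m * (m - 1) * m < m * (m - 1) * sum x A"
    using lt by (simp add: q_def B_def power2_eq_square mult.commute mult.left_commute)
  then have gt: "m < sum x A" using m by simp
  have "q \<noteq> 0"
  proof
    assume "q = 0"
    then show False using gt sA m by simp
  qed
  then have q: "q > 0" by (simp add: q_def)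
  have "m * (\<Sum>v\<in>V. (x v)\<^sup>2) < qform (kplus A B a b) x"
  proof -
    have V2: "sum f V = sum f A + sum f B" for f :: "'a \<Rightarrow> real"
      unfolding fin(4) using fin by (intro sum.union_disjoint) auto
    have "m * (\<Sum>v\<in>V. (x v)\<^sup>2) = (\<Sum>v\<in>A. x v * nbsum (kplus A B a b) x v) + q * m"
      unfolding V2 using A xs(1)
      by (simp add: q_def distrib_left sum_distrib_left power2_eq_square mult.left_commute)
    also have "\<dots> < (\<Sum>v\<in>A. x v * nbsum (kplus A B a b) x v) + q * sum x A"
      using gt q by simp
    also have "\<dots> = qform (kplus A B a b) x"
      unfolding qform_eq_nbsum[OF g] V2 using nb(1) xs(1) by (simp add: q_def)
    finally show ?thesis .
  qed
  also have "\<dots> \<le> lam V (kplus A B a b) * (\<Sum>v\<in>V. (x v)\<^sup>2)" by (rule qform_le_lam[OF g \<open>V \<noteq> {}\<close>])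
  finally have "m * (\<Sum>v\<in>V. (x v)\<^sup>2) < lam V (kplus A B a b) * (\<Sum>v\<in>V. (x v)\<^sup>2)" .
  then show ?thesis
    unfolding B_def[symmetric] by (rule mult_right_less_imp_less) (simp add: sum_nonneg)
qed

lemma lam_balanced_kplus_gt:
  assumes V: "finite V" "A \<subseteq> V" "a \<in> A" "b \<in> A" "a \<noteq> b" and A: "card A = card V div 2"
  shows "(lam V (kplus A (V - A) a b))\<^sup>2 > real (card V div 2 * (card V - card V div 2) + 2)"
    and "lam V (kplus A (V - A) a b) > 1"
proof -
  define p where "p = real (card V div 2)"
  define q where "q = real (card V - card V div 2)"
  have cB: "card (V - A) = card V - card V div 2"
    using V A by (simp add: card_Diff_subset finite_subset)
  have q: "q \<ge> p" "p \<ge> 0" by (auto simp: p_def q_def)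
  have p: "p \<ge> 2"
  proof -
    have "card {a, b} \<le> card A" using V by (intro card_mono) (auto intro: finite_subset)
    then show ?thesis using V(5) A by (simp add: p_def)
  qed
  \<comment> \<open>The threshold from the walk bounds. For this \<open>m\<close> the condition of
    \<open>lam_kplus_gt\<close> reduces to \<open>m < q + 1\<close>.\<close>
  define m where "m = sqrt (p * q + 2)"
  have m2: "m\<^sup>2 = p * q + 2" using q by (simp add: m_def)
  have m1: "m > 1"
  proof -
    have "p * q \<ge> 0" using q by simp
    then show ?thesis unfolding m_def by simp
  qed
  have "m < q + 1"
  proof (rule power2_less_imp_less)
    have "p * q \<le> q * q" "q \<ge> 2" using q p by (auto intro: mult_right_mono)
    moreover have "(q + 1)\<^sup>2 = q * q + 2 * q + 1" by (simp add: power2_eq_square algebra_simps)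
    ultimately show "m\<^sup>2 < (q + 1)\<^sup>2" unfolding m2 by linarith
  qed (use q in auto)
  then have "m\<^sup>2 * (m - 1) < q * (p * (m - 1) + 2)"
    unfolding m2 by (simp add: algebra_simps)
  then have gt: "m < lam V (kplus A (V - A) a b)"
    using lam_kplus_gt[OF V m1] A cB by (simp add: p_def q_def)
  then show "lam V (kplus A (V - A) a b) > 1" using m1 by simp
  have "m\<^sup>2 < (lam V (kplus A (V - A) a b))\<^sup>2"
    using gt m1 by (intro power_strict_mono) auto
  then show "(lam V (kplus A (V - A) a b))\<^sup>2 > real (card V div 2 * (card V - card V div 2) + 2)"
    unfolding m2 p_def q_def by simp
qed

text \<open>The weight is \<open>(l - 1)\<close> times the product of the sizes plus twice the
  second size. Shrinking the first part by \<open>t\<close> gains \<open>2 * t\<close> but loses at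
  least \<open>(l - 1) * t\<close> in the product, and \<open>l > 3\<close>; enlarging it cannot
  raise the product and lowers the second size.\<close>

lemma size_weight_less:
  fixes p p' n :: nat and l :: real
  assumes "p \<le> n" "p \<noteq> n div 2" "l > 3"
  shows "real (n - p) * (real p * (l - 1) + 2)
    < real (n - n div 2) * (real (n div 2) * (l - 1) + 2)"
proof -
  define P where "P = real (n div 2)"
  define Q where "Q = real (n - n div 2)"
  define t where "t = P - real p"
  have QP: "Q \<ge> P" "P \<ge> 0" by (auto simp: P_def Q_def)
  have p: "real p = P - t" by (simp add: t_def)
  have q: "real (n - p) = Q + t" using assms(1) by (simp add: t_def P_def Q_def of_nat_diff)
  show ?thesis
  proof (cases "p < n div 2")
    case True
    then have t: "t \<ge> 1" unfolding t_def P_def by linarith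
    have "0 \<le> t * (Q - P)" "t * 1 \<le> t * t" using t QP by (auto intro: mult_left_mono)
    then have "t \<le> t * (Q - P) + t * t" by linarith
    then have "(l - 1) * t \<le> (l - 1) * (t * (Q - P) + t * t)"
      using assms(3) by (intro mult_left_mono) auto
    moreover have "2 * t < (l - 1) * t" using t assms(3) by (intro mult_strict_right_mono) auto
    ultimately show ?thesis
      unfolding P_def[symmetric] Q_def[symmetric] p q by (simp add: algebra_simps)
  next
    case False
    then have t: "t < 0" using assms(2) unfolding t_def P_def by linarith
    have "real (p * (n - p)) \<le> real (n div 2 * (n - n div 2))"
      using mult_diff_le_floor[OF assms(1)] by (simp only: of_nat_le_iff)
    then have "(l - 1) * ((P - t) * (Q + t)) \<le> (l - 1) * (P * Q)"
      using assms(3) unfolding of_nat_mult p q P_def[symmetric] Q_def[symmetric]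
      by (intro mult_left_mono) auto
    then show ?thesis
      unfolding P_def[symmetric] Q_def[symmetric] p q using t by (simp add: algebra_simps)
  qed
qed

lemma ex_balanced_part:
  assumes fin: "finite V" and n: "card V \<ge> 4"
  obtains A a b where "A \<subseteq> V" "a \<in> A" "b \<in> A" "a \<noteq> b" "card A = card V div 2"
proof -
  have "card V div 2 \<le> card V" by simp
  then obtain A where A: "A \<subseteq> V" "card A = card V div 2"
    by (rule obtain_subset_with_card_n)
  have "\<not> card A \<le> Suc 0" using A(2) n by simp
  then obtain a b where "a \<in> A" "b \<in> A" "a \<noteq> b"
    using card_le_Suc0_iff_eq[of A] finite_subset[OF A(1) fin] by blast
  then show ?thesis using A that by blast
qed

text \<open>At the eigenvalue \<open>l\<close> of an unbalanced graph, the right-hand side of the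
  eigenvalue equation becomes strictly larger for balanced sizes, so the balanced graph has spectral
  radius above \<open>l\<close>.\<close>

lemma card_part_of_extremal_kplus:
  assumes ex: "extremal V (kplus A (V - A) a b)" and n: "card V \<ge> 7"
    and V: "A \<subseteq> V" "a \<in> A" "b \<in> A" "a \<noteq> b"
  shows "card A = card V div 2"
proof (rule ccontr)
  assume ne: "card A \<noteq> card V div 2"
  define l where "l = lam V (kplus A (V - A) a b)"
  have fin: "finite V" using ex by (auto simp: extremal_def graph_on_def)
  have n4: "4 \<le> card V" using n by simp
  obtain A' a' b' where A': "A' \<subseteq> V" "a' \<in> A'" "b' \<in> A'" "a' \<noteq> b'" "card A' = card V div 2"
    using ex_balanced_part[OF fin n4] by blast
  let ?K = "kplus A' (V - A') a' b'"
  have "graph_on V ?K"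
    using graph_on_kplus[of A' "V - A'" a' b'] A' fin by (simp add: finite_subset Un_absorb1)
  moreover have "bowtie_free ?K" using A' by (intro bowtie_free_kplus) auto
  ultimately have le: "lam V ?K \<le> l" using ex by (simp add: extremal_def l_def)
  have l3: "l > 3"
  proof -
    note * = lam_balanced_kplus_gt[OF fin A']
    define M where "M = card V div 2 * (card V - card V div 2) + 2"
    \<comment> \<open>The parts have at least 3 and 4 vertices, which makes the squared spectral
      radius exceed 9, as \<open>size_weight_less\<close> requires.\<close>
    have "(card V div 2) * (card V - card V div 2) \<ge> 3 * 4" using n by (intro mult_mono) auto
    then have "9 \<le> M" unfolding M_def by linarith
    then have "3\<^sup>2 \<le> real M" by simp
    then have "3\<^sup>2 < (lam V ?K)\<^sup>2" using *(1) unfolding M_def[symmetric] by linarith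
    moreover have "0 \<le> lam V ?K" using *(2) by linarith
    ultimately have "3 < lam V ?K" by (rule power2_less_imp_less)
    then show ?thesis using le by simp
  qed
  have c: "card (V - A) = card V - card A" "card (V - A') = card V - card V div 2"
    using V A' fin by (auto simp: card_Diff_subset finite_subset)
  have "l\<^sup>2 * (l - 1) = real (card V - card A) * (real (card A) * (l - 1) + 2)"
    using lam_kplus_eq[OF fin V l_def[symmetric]] l3 c by simp
  also have "\<dots> < real (card V - card V div 2) * (real (card V div 2) * (l - 1) + 2)"
    using card_mono[OF fin V(1)] ne l3 by (intro size_weight_less) auto
  finally have "l < lam V ?K"
    using lam_kplus_gt[OF fin A'(1-4), of l] l3 c A'(5) by simp
  then show False using le by simp
qed

section \<open>Isomorphism invariance\<close>

lemma digraph_iso_image: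
  assumes wf: "pair_wf_digraph G" and inj: "inj_on f (pverts G)"
  shows "digraph_iso (with_proj G)
    (with_proj \<lparr>pverts = f ` pverts G, parcs = map_prod f f ` parcs G\<rparr>)"
proof -
  interpret pair_wf_digraph G by (rule wf)
  let ?h = "\<lparr>iso_verts = f, iso_arcs = map_prod f f, iso_head = snd, iso_tail = fst\<rparr>"
  have "inj_on (map_prod f f) (parcs G)"
  proof (rule inj_on_subset)
    show "inj_on (map_prod f f) (pverts G \<times> pverts G)" by (rule map_prod_inj_on[OF inj inj])
  qed (use in_arcsD1 in_arcsD2 in auto)
  then have "digraph_isomorphism ?h"
    using inj wf by (auto simp: digraph_isomorphism_def wf_digraph_wp_iff)
  then show ?thesis
    unfolding digraph_iso_def by (intro exI[of _ ?h]) (auto simp: app_iso_def with_proj_def)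
qed

text \<open>Both digraphs use the projections as tail and head, so the arc map is determined by the
  vertex map.\<close>

lemma digraph_isoE:
  assumes "digraph_iso (with_proj G) (with_proj H)"
  obtains f where "inj_on f (pverts G)" "pverts H = f ` pverts G" "parcs H = map_prod f f ` parcs G"
proof -
  from assms obtain h where h: "pre_digraph.digraph_isomorphism (with_proj G) h"
    "with_proj H = app_iso h (with_proj G)" by (auto simp: digraph_iso_def)
  have H: "pverts H = iso_verts h ` pverts G" "parcs H = iso_arcs h ` parcs G"
    "iso_tail h = fst" "iso_head h = snd"
    using h(2) by (auto simp: with_proj_def app_iso_def)
  have "iso_arcs h e = map_prod (iso_verts h) (iso_verts h) e" if "e \<in> parcs G" for e
    using h(1) that H(3,4) by (auto simp: pre_digraph.digraph_isomorphism_def prod_eq_iff)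
  then have "parcs H = map_prod (iso_verts h) (iso_verts h) ` parcs G"
    unfolding H(2) by (intro image_cong) auto
  moreover have "inj_on (iso_verts h) (pverts G)"
    using h(1) by (simp add: pre_digraph.digraph_isomorphism_def)
  ultimately show ?thesis using H(1) that by blast
qed

text \<open>Transporting a vertex ordering along the isomorphism gives literally the same adjacency
  matrix.\<close>

lemma graph_spectral_radius_iso:
  assumes fin: "finite (pverts G)" and wf: "parcs G \<subseteq> pverts G \<times> pverts G"
    and iso: "digraph_iso (with_proj G) (with_proj H)"
  shows "graph_spectral_radius H = graph_spectral_radius G"
proof -
  obtain f where f: "inj_on f (pverts G)" "pverts H = f ` pverts G" "parcs H = map_prod f f ` parcs G"
    using iso by (rule digraph_isoE)
  obtain vs where vs: "distinct vs" "set vs = pverts G" using finite_distinct_list[OF fin] by blast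
  have "adjacency_matrix H (map f vs) = adjacency_matrix G vs"
  proof (rule eq_matI)
    fix i j assume "i < dim_row (adjacency_matrix G vs)" "j < dim_col (adjacency_matrix G vs)"
    then have ij: "i < length vs" "j < length vs" by (auto simp: adjacency_matrix_def)
    then have "vs ! i \<in> pverts G" "vs ! j \<in> pverts G" unfolding vs(2)[symmetric] by simp_all
    then have "(f (vs ! i), f (vs ! j)) \<in> parcs H \<longleftrightarrow> (vs ! i, vs ! j) \<in> parcs G"
      unfolding f(3)
      using inj_on_image_mem_iff[OF map_prod_inj_on[OF f(1) f(1)] _ wf, of "(vs ! i, vs ! j)"] by simp
    then show "adjacency_matrix H (map f vs) $$ (i, j) = adjacency_matrix G vs $$ (i, j)"
      using ij by (simp add: adjacency_matrix_def)
  qed (auto simp: adjacency_matrix_def)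
  moreover have "vertex_ordering H (map f vs)" "vertex_ordering G vs"
    using vs f by (auto simp: vertex_ordering_def distinct_map)
  ultimately show ?thesis by (simp add: graph_spectral_radius_eq)
qed

lemma graph_free_bowtie_imp_bowtie_free:
  assumes G: "pair_graph G" and free: "graph_free bowtie G"
  shows "bowtie_free (parcs G)"
  unfolding bowtie_free_def
proof (intro allI impI, elim conjE, rule ccontr)
  interpret pair_graph G by (rule G)
  fix a b c d e
  assume E: "(a, b) \<in> parcs G" "(a, c) \<in> parcs G" "(b, c) \<in> parcs G"
    "(a, d) \<in> parcs G" "(a, e) \<in> parcs G" "(d, e) \<in> parcs G"
    and ne: "\<not> (b = d \<or> b = e \<or> c = d \<or> c = e)"
  have sy: "(v, u) \<in> parcs G" if "(u, v) \<in> parcs G" for u v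
    using that pair_sym_arcs by (auto simp: symmetric_def dest: symD)
  have irr: "(v, v) \<notin> parcs G" for v using pair_no_loops by fastforce
  define f where "f = (\<lambda>i::nat. [a, b, c, d, e] ! i)"
  have five: "{..<5::nat} = {0, 1, 2, 3, 4}" by auto
  have f: "f 0 = a" "f 1 = b" "f 2 = c" "f 3 = d" "f 4 = e" by (simp_all add: f_def)
  have "a \<noteq> b" "a \<noteq> c" "b \<noteq> c" "a \<noteq> d" "a \<noteq> e" "d \<noteq> e" using E irr by auto
  then have inj: "inj_on f (pverts bowtie)"
    using ne f by (auto simp: bowtie_def mk_symmetric_def five inj_on_def)
  let ?H = "\<lparr>pverts = f ` pverts bowtie, parcs = map_prod f f ` parcs bowtie\<rparr>"
  have "pair_wf_digraph bowtie" using pair_graph_bowtie by (simp add: pair_graph_def pair_digraph_def pair_fin_digraph_def)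
  from digraph_iso_image[OF this inj] have iso: "digraph_iso (with_proj bowtie) (with_proj ?H)" .
  have pb: "parcs bowtie = {(0, 1), (0, 2), (1, 2), (0, 3), (0, 4), (3, 4),
      (1, 0), (2, 0), (2, 1), (3, 0), (4, 0), (4, 3)}" "pverts bowtie = {0, 1, 2, 3, 4}"
    by (auto simp: bowtie_def mk_symmetric_def five)
  have "parcs ?H \<subseteq> parcs G" using E sy f by (simp add: pb)
  moreover have "pverts ?H \<subseteq> pverts G" using E f in_arcsD1 in_arcsD2 by (auto simp: pb)
  moreover have "pair_wf_digraph ?H" by unfold_locales (auto simp: pb)
  ultimately have "subgraph (with_proj ?H) (with_proj G)"
    using pair_wf_digraph_axioms
    by (auto simp: subgraph_def wf_digraph_wp_iff compatible_def)
  with iso free show False unfolding graph_free_def by blast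
qed

lemma kplus_iso_complete_bipartite_plus:
  assumes V: "finite V" "A \<subseteq> V" "a \<in> A" "b \<in> A" "a \<noteq> b"
  shows "digraph_iso (with_proj \<lparr>pverts = V, parcs = kplus A (V - A) a b\<rparr>)
    (with_proj (complete_bipartite_plus (card A) (card (V - A))))"
proof -
  define p where "p = card A"
  define q where "q = card (V - A)"
  define B where "B = V - A"
  have fin: "finite A" "finite B" "A \<inter> B = {}" "V = A \<union> B"
    using V by (auto simp: B_def intro: finite_subset)
  have "card {a, b} \<le> p" unfolding p_def using V fin by (intro card_mono) auto
  then have p2: "p \<ge> 2" using V(5) by simp
  have "card (A - {a, b}) = card {2..<p}" using V fin by (simp add: p_def card_Diff_subset)
  then obtain h where h: "bij_betw h (A - {a, b}) {2..<p}"
    using finite_same_card_bij[of "A - {a, b}" "{2..<p}"] fin by auto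
  have "card B = card {p..<p + q}" by (simp add: q_def B_def)
  then obtain k where k: "bij_betw k B {p..<p + q}"
    using finite_same_card_bij[of B "{p..<p + q}"] fin by auto
  define f where "f v = (if v = a then 0 else if v = b then 1 else if v \<in> A then h v else k v)" for v
  have fh: "f v = h v" if "v \<in> A - {a, b}" for v using that by (auto simp: f_def)
  have fk: "f v = k v" if "v \<in> B" for v using that fin V by (auto simp: f_def)
  have fab: "f a = 0" "f b = 1" using V by (auto simp: f_def)
  have fA': "bij_betw f (A - {a, b}) {2..<p}" using h bij_betw_cong[of "A - {a, b}" f h] fh by blast
  have "bij_betw f {a, b} {0, 1}" using fab V(5) by (auto simp: bij_betw_def)
  then have "bij_betw f ((A - {a, b}) \<union> {a, b}) ({2..<p} \<union> {0, 1})"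
    by (rule bij_betw_combine[OF fA']) auto
  moreover have "(A - {a, b}) \<union> {a, b} = A" "{2..<p} \<union> {0, 1} = {..<p}" using V p2 by auto
  ultimately have fA: "bij_betw f A {..<p}" by simp
  have fB: "bij_betw f B {p..<p + q}" using k bij_betw_cong[of B f k] fk by blast
  have "bij_betw f (A \<union> B) ({..<p} \<union> {p..<p + q})" by (rule bij_betw_combine[OF fA fB]) auto
  moreover have "{..<p} \<union> {p..<p + q} = {..<p + q}" by auto
  ultimately have fV: "bij_betw f V {..<p + q}" using fin(4) by simp
  have im: "f ` A = {..<p}" "f ` B = {p..<p + q}" "f ` V = {..<p + q}"
    using fA fB fV by (auto simp: bij_betw_def)
  have prod: "map_prod f f ` (X \<times> Y) = f ` X \<times> f ` Y" for X Y by auto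
  have "map_prod f f ` kplus A B a b
      = {..<p} \<times> {p..<p + q} \<union> {p..<p + q} \<times> {..<p} \<union> {(0, 1), (1, 0)}"
    unfolding kplus_def image_Un prod im using fab by simp
  then have eq: "\<lparr>pverts = f ` V, parcs = map_prod f f ` kplus A B a b\<rparr> = complete_bipartite_plus p q"
    unfolding im by (simp add: complete_bipartite_plus_def complete_bipartite_def)
  have "pair_wf_digraph \<lparr>pverts = V, parcs = kplus A B a b\<rparr>"
    by unfold_locales (use V fin(4) in \<open>auto simp: kplus_def\<close>)
  from digraph_iso_image[OF this, of f] fV eq show ?thesis
    by (simp add: bij_betw_def p_def q_def B_def)
qed

section \<open>Existence of extremal graphs and the conclusion\<close>

lemma ex_extremal:
  assumes "finite V"
  shows "\<exists>E. extremal V E"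
proof -
  let ?F = "{E. graph_on V E \<and> bowtie_free E}"
  have "?F \<subseteq> Pow (V \<times> V)" by (auto simp: graph_on_def)
  then have fin: "finite ?F" using assms by (simp add: finite_subset)
  have "{} \<in> ?F" using assms by (auto simp: graph_on_def bowtie_free_def sym_def)
  then have "Max (lam V ` ?F) \<in> lam V ` ?F" using fin by (intro Max_in) auto
  then obtain E where E: "E \<in> ?F" "lam V E = Max (lam V ` ?F)" by auto
  have "lam V E' \<le> lam V E" if "E' \<in> ?F" for E' unfolding E(2) using fin that by (intro Max_ge) auto
  then show ?thesis using E(1) by (auto simp: extremal_def)
qed

lemma extremal_is_balanced_kplus:
  assumes ex: "extremal V E" and n: "card V \<ge> 7"
  shows "\<exists>A a b. A \<subseteq> V \<and> a \<in> A \<and> b \<in> A \<and> a \<noteq> b \<and> card A = card V div 2 \<and> E = kplus A (V - A) a b"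
proof -
  have fin: "finite V" using ex by (auto simp: extremal_def graph_on_def)
  have n4: "4 \<le> card V" using n by simp
  obtain A a b where A: "A \<subseteq> V" "a \<in> A" "b \<in> A" "a \<noteq> b" "card A = card V div 2"
    using ex_balanced_part[OF fin n4] by blast
  let ?K = "kplus A (V - A) a b"
  have "graph_on V ?K"
    using graph_on_kplus[of A "V - A" a b] A fin by (simp add: finite_subset Un_absorb1)
  moreover have "bowtie_free ?K" using A by (intro bowtie_free_kplus) auto
  ultimately have le: "lam V ?K \<le> lam V E" using ex by (simp add: extremal_def)
  note K = lam_balanced_kplus_gt[OF fin A]
  have "(lam V ?K)\<^sup>2 \<le> (lam V E)\<^sup>2" using le K(2) by (intro power_mono) auto
  then have "(lam V E)\<^sup>2 > real (card V div 2 * (card V - card V div 2) + 2)" using K(1) by linarith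
  moreover have "lam V E \<ge> 0" using K(2) le by linarith
  ultimately obtain A' a' b' where
    A': "A' \<subseteq> V" "a' \<in> A'" "b' \<in> A'" "a' \<noteq> b'" "E = kplus A' (V - A') a' b'"
    using extremal_structure[OF ex n] by blast
  then have "card A' = card V div 2" using card_part_of_extremal_kplus[of V A' a' b'] ex n by blast
  then show ?thesis using A' by blast
qed

theorem theorem1p7:
  fixes G :: "'a pair_pre_digraph" and n :: nat
  assumes "n \<ge> 7"
    and "pair_graph G"
    and "card (pverts G) = n"
    and "graph_free bowtie G"
  shows "graph_spectral_radius G
           \<le> graph_spectral_radius (complete_bipartite_plus (n div 2) (n - n div 2)) \<and>
         (graph_spectral_radius G
           = graph_spectral_radius (complete_bipartite_plus (n div 2) (n - n div 2)) \<longleftrightarrow>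
         digraph_iso (with_proj G) (with_proj (complete_bipartite_plus (n div 2) (n - n div 2))))"
proof -
  interpret pair_graph G by (rule assms)
  define V where "V = pverts G"
  define E where "E = parcs G"
  let ?K = "complete_bipartite_plus (n div 2) (n - n div 2)"
  have G: "G = \<lparr>pverts = V, parcs = E\<rparr>" by (simp add: V_def E_def)
  have EV: "E \<subseteq> V \<times> V" using in_arcsD1 in_arcsD2 by (auto simp: V_def E_def)
  have fin: "finite V" by (simp add: V_def pair_finite_verts)
  have n: "card V = n" using assms by (simp add: V_def)
  have g: "graph_on V E"
    using EV fin pair_sym_arcs pair_no_loops
    by (fastforce simp: graph_on_def symmetric_def E_def)
  have bf: "bowtie_free E" unfolding E_def by (rule graph_free_bowtie_imp_bowtie_free[OF assms(2,4)])
  have iso: "digraph_iso (with_proj \<lparr>pverts = V, parcs = E'\<rparr>) (with_proj ?K)" if ex: "extremal V E'" for E'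
  proof -
    obtain A a b where A: "A \<subseteq> V" "a \<in> A" "b \<in> A" "a \<noteq> b" "card A = n div 2" "E' = kplus A (V - A) a b"
      using extremal_is_balanced_kplus[OF ex] n assms(1) by blast
    have "card (V - A) = n - n div 2"
      using A(1,5) fin n by (simp add: card_Diff_subset finite_subset)
    then show ?thesis using kplus_iso_complete_bipartite_plus[OF fin A(1-4)] A(5,6) by simp
  qed
  \<comment> \<open>Any extremal graph on \<open>V\<close> is isomorphic to \<open>?K\<close>, so
    \<open>E0\<close> transfers the spectral radius of \<open>?K\<close> to the vertex type of
    \<open>G\<close>, where it is the maximum.\<close>
  obtain E0 where E0: "extremal V E0" using ex_extremal[OF fin] by blast
  have "E0 \<subseteq> V \<times> V" using E0 by (simp add: extremal_def graph_on_def)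
  then have K: "graph_spectral_radius ?K = lam V E0"
    using graph_spectral_radius_iso[OF _ _ iso[OF E0]] fin by (simp add: lam_def)
  have le: "lam V E \<le> lam V E0" using E0 g bf by (simp add: extremal_def)
  have "extremal V E" if "lam V E = lam V E0"
    using E0 g bf that by (simp add: extremal_def)
  then have "lam V E = lam V E0 \<Longrightarrow> digraph_iso (with_proj G) (with_proj ?K)"
    using iso G by simp
  moreover have "digraph_iso (with_proj G) (with_proj ?K) \<Longrightarrow> graph_spectral_radius ?K = graph_spectral_radius G"
    using fin EV by (intro graph_spectral_radius_iso) (auto simp: V_def E_def)
  moreover have "graph_spectral_radius G = lam V E" unfolding lam_def G ..
  ultimately show ?thesis using le K by auto
qed

end
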